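(* Let $\mathcal{C}\subset\mathbb{R}^n$ be a degree $d$ affine rational curve with parametrization $$t\mapsto\left(\frac{\varphi_1(t)}{\varphi_0(t)},\dots,\frac{\varphi_n(t)}{\varphi_0(t)}\right),$$ where $\varphi_0,\dots,\varphi_n\in\mathbb{R}[t]$, $\deg\varphi_i=d_i\le d$ and $D=\max\{d_1,\dots,d_n\}$. Suppose $\varphi_0$ has $p\ge 0$ distinct real zeros. Let $s\in\mathbb{N}$. Then every positive Borel measure supported on $\mathcal{C}$ with finite moments up to degree $2s$ admits a quadrature rule of strength $2s$ with at most $$N\;\le\; Ds+p+1$$ nodes.
   Context: A rational curve in $\mathbb{R}^n$ is a real algebraic curve of genus zero admitting a parametrization $\mathbb{R}\dashrightarrow\mathbb{R}^n$ by rational functions; it may be singular. A measure $\mu$ is supported on $\mathcal{C}$ if its support (the smallest closed set whose complement has measure zero) is contained in $\mathcal{C}$. Finite moments up to degree $k$ means that $\int x^\alpha\,d\mu$ exists and is finite for all $|\alpha|\le k$. A quadrature rule of strength $k$ for $\mu$ is a finite set of nodes $\{p_1,\dots,p_\ell\}\subset\mathbb{R}^n$ together with positive real weights $w(p_1),\dots,w(p_\ell)>0$ such that $\int p\,d\mu=\sum_{j=1}^{\ell}w(p_j)\,p(p_j)$ for all polynomials $p\in\mathbb{R}[x_1,\dots,x_n]$ of degree at most $k$; its number of nodes is $\ell$.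
   Formalization: The bound is proved with D replaced by max{d_0, d_1, ..., d_n}; with D = max{d_1, ..., d_n} it fails when deg φ_0 > D, e.g. x = 1/t (D = 0, p = 1) and the Gaussian measure on the line with s = 2, which needs 3 nodes. *)

theory Defs
  imports "HOL-Analysis.Analysis" "HOL-Computational_Algebra.Polynomial" "HOL-Library.Extended_Nat"
begin

section \<open>Polynomial functions in several variables\<close>

text \<open>Multi-indices are functions \<open>\<alpha> :: 'n \<Rightarrow> nat\<close>. Over the infinite fields used here,
  polynomials and polynomial functions are the same thing.\<close>

definition mono_fun :: "('n::finite \<Rightarrow> nat) \<Rightarrow> 'a::comm_semiring_1 ^ 'n \<Rightarrow> 'a" where
  "mono_fun \<alpha> x = (\<Prod>i\<in>UNIV. (x $ i) ^ \<alpha> i)"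

definition multi_indices :: "nat \<Rightarrow> ('n::finite \<Rightarrow> nat) set" where
  "multi_indices k = {\<alpha>. (\<Sum>i\<in>UNIV. \<alpha> i) \<le> k}"

lemma finite_multi_indices: "finite (multi_indices k :: ('n::finite \<Rightarrow> nat) set)"
proof (rule finite_subset)
  show "multi_indices k \<subseteq> (\<Pi>\<^sub>E i\<in>(UNIV :: 'n set). {..k})"
  proof
    fix \<alpha> :: "'n \<Rightarrow> nat" assume a: "\<alpha> \<in> multi_indices k"
    have "\<alpha> i \<le> k" for i
    proof -
      have "\<alpha> i \<le> (\<Sum>j\<in>UNIV. \<alpha> j)" by (rule member_le_sum) auto
      with a show ?thesis by (simp add: multi_indices_def)
    qed
    then show "\<alpha> \<in> (\<Pi>\<^sub>E i\<in>UNIV. {..k})" by auto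
  qed
  show "finite (\<Pi>\<^sub>E i\<in>(UNIV :: 'n set). {..k})" by (intro finite_PiE) auto
qed

definition poly_funs :: "nat \<Rightarrow> ('a::comm_semiring_1 ^ 'n::finite \<Rightarrow> 'a) set" where
  "poly_funs k = {f. \<exists>c. \<forall>x. f x = (\<Sum>\<alpha>\<in>multi_indices k. c \<alpha> * mono_fun \<alpha> x)}"

section \<open>Algebraic sets and curves\<close>

definition zariski_closure :: "('a::comm_ring_1 ^ 'n::finite) set \<Rightarrow> ('a ^ 'n) set" where
  "zariski_closure S = {x. \<forall>k. \<forall>f\<in>poly_funs k. (\<forall>y\<in>S. f y = 0) \<longrightarrow> f x = 0}"

definition zariski_closed :: "('a::comm_ring_1 ^ 'n::finite) set \<Rightarrow> bool" where
  "zariski_closed X \<longleftrightarrow> zariski_closure X = X"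

definition zariski_irreducible :: "('a::comm_ring_1 ^ 'n::finite) set \<Rightarrow> bool" where
  "zariski_irreducible X \<longleftrightarrow> X \<noteq> {} \<and>
     (\<forall>A B. zariski_closed A \<and> zariski_closed B \<and> X \<subseteq> A \<union> B \<longrightarrow> X \<subseteq> A \<or> X \<subseteq> B)"

definition zariski_dim :: "('a::comm_ring_1 ^ 'n::finite) set \<Rightarrow> enat" where
  "zariski_dim X = Sup {enat k | k. \<exists>Y :: nat \<Rightarrow> ('a ^ 'n) set.
     (\<forall>i\<le>k. zariski_closed (Y i) \<and> zariski_irreducible (Y i) \<and> Y i \<subseteq> X) \<and>
     (\<forall>i<k. Y i \<subset> Y (Suc i))}"

definition real_algebraic_curve :: "(real ^ 'n::finite) set \<Rightarrow> bool" where
  "real_algebraic_curve C \<longleftrightarrow> zariski_closed C \<and> zariski_irreducible C \<and> zariski_dim C = 1"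

definition param_image :: "real poly \<Rightarrow> ('n::finite \<Rightarrow> real poly) \<Rightarrow> (real ^ 'n) set" where
  "param_image \<phi>0 \<phi> = {(\<chi> i. poly (\<phi> i) t / poly \<phi>0 t) | t. poly \<phi>0 t \<noteq> 0}"

text \<open>A parametrization is a dominant rational map: its image is Zariski dense in the curve but
  may miss some of its real points (the limit for \<open>t \<rightarrow> \<infinity>\<close>, or isolated real points coming from
  non-real parameters). By Lueroth's theorem the curve then automatically has genus zero.\<close>

definition rational_curve_param ::
    "(real ^ 'n::finite) set \<Rightarrow> real poly \<Rightarrow> ('n \<Rightarrow> real poly) \<Rightarrow> bool" where
  "rational_curve_param C \<phi>0 \<phi> \<longleftrightarrow>
     real_algebraic_curve C \<and> \<phi>0 \<noteq> 0 \<and> zariski_closure (param_image \<phi>0 \<phi>) = C"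

definition complexification :: "(real ^ 'n::finite) set \<Rightarrow> (complex ^ 'n) set" where
  "complexification C = zariski_closure ((\<lambda>x. \<chi> i. complex_of_real (x $ i)) ` C)"

text \<open>The degree is the number of points in which the complexified curve meets a general
  hyperplane. The vector \<open>h\<close> stands for the affine hyperplane
  \<open>h $ None + (\<Sum>i. h $ Some i * z $ i) = 0\<close>, and general means outside the zero set of some nonzero
  polynomial \<open>g\<close> in \<open>h\<close>. A general hyperplane meets the projective closure of the curve only in
  affine points.\<close>

definition curve_degree :: "(real ^ 'n::finite) set \<Rightarrow> nat \<Rightarrow> bool" where
  "curve_degree C d \<longleftrightarrow>
     (\<exists>k. \<exists>g \<in> (poly_funs k :: (complex ^ 'n option \<Rightarrow> complex) set).
        (\<exists>h. g h \<noteq> 0) \<and>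
        (\<forall>h. g h \<noteq> 0 \<longrightarrow>
           (let I = {z \<in> complexification C. h $ None + (\<Sum>i\<in>UNIV. h $ Some i * z $ i) = 0}
            in finite I \<and> card I = d)))"

section \<open>Measures and quadrature rules\<close>

text \<open>On a second countable space the intersection of all closed sets with null complement again
  has null complement, so it is the smallest such set.\<close>

definition measure_support :: "'a::topological_space measure \<Rightarrow> 'a set" where
  "measure_support \<mu> = \<Inter>{F. closed F \<and> emeasure \<mu> (- F) = 0}"

definition finite_moments :: "(real ^ 'n::finite) measure \<Rightarrow> nat \<Rightarrow> bool" where
  "finite_moments \<mu> k \<longleftrightarrow> (\<forall>\<alpha>\<in>multi_indices k. integrable \<mu> (mono_fun \<alpha>))"

definition quadrature_rule ::
    "(real ^ 'n::finite) measure \<Rightarrow> nat \<Rightarrow> (real ^ 'n) set \<Rightarrow> (real ^ 'n \<Rightarrow> real) \<Rightarrow> bool" where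
  "quadrature_rule \<mu> k P w \<longleftrightarrow>
     finite P \<and> (\<forall>x\<in>P. w x > 0) \<and>
     (\<forall>f\<in>poly_funs k. (LINT x|\<mu>. f x) = (\<Sum>x\<in>P. w x * f x))"

end

theory Submission
  imports Defs "HOL-Computational_Algebra.Fundamental_Theorem_Algebra"
begin

text \<open>A function of degree \<open>2s\<close> pulls back along the parametrization to a polynomial in \<open>t\<close> of degree at
  most \<open>2sm\<close>, where \<open>m\<close> is the maximal degree of the \<open>\<phi>\<^sub>i\<close>. If the function is nonnegative on the curve,
  each of its zeros there uses up two zeros of the pullback: a double one at a real parameter, or a
  conjugate pair when the point is isolated and comes only from nonreal parameters. Moments of a
  measure that lie on the boundary of the moment cone are annihilated by such a function, so they
  have at most \<open>sm\<close> nodes. The general case is reduced to this one by first replacing the measure by a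
  discrete one and then splitting off as much mass as possible at one fixed point of the curve. The
  splitting needs a compact piece of the curve; cutting off the real poles and \<open>t = \<infinity>\<close> creates
  \<open>2p + 2\<close> end points at which zeros may be simple, which accounts for the extra \<open>p + 1\<close> nodes.\<close>

section \<open>Convex cones of moments\<close>

text \<open>When \<open>C\<close> is unbounded, its moment cone need not be closed: nodes can run
  off to infinity while their weights tend to zero, so the largest mass that can be split off at a
  point need not be attained. This is why the measure is made discrete first. Finitely many nodes
  lie over a compact set of parameters, provided that none of them sits at t = \<infinity>; hence
  the change of parameter. A second obstacle is that \<open>C\<close> is a Zariski closure and may
  contain points that the real parametrization misses. An elimination argument shows that each of
  them still has a complex parameter or is the point at t = \<infinity>, so that one univariate
  polynomial controls the zeros on the curve.\<close>

definition cone_mem :: "'i set \<Rightarrow> ('i \<Rightarrow> 'a \<Rightarrow> real) \<Rightarrow> 'a set \<Rightarrow> ('i \<Rightarrow> real) \<Rightarrow> bool" where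
  "cone_mem I b K y \<longleftrightarrow> (\<exists>P w. finite P \<and> P \<subseteq> K \<and> (\<forall>x\<in>P. 0 \<le> w x) \<and>
     (\<forall>i\<in>I. y i = (\<Sum>x\<in>P. w x * b i x)))"

text \<open>Bartl's proof by induction on the generators, valid for an arbitrary coefficient space.\<close>

lemma farkas:
  fixes b :: "'i \<Rightarrow> 'a \<Rightarrow> real"
  assumes "finite I" "finite G"
  shows "(\<exists>w. (\<forall>x\<in>G. 0 \<le> w x) \<and> (\<forall>i\<in>I. y i = (\<Sum>x\<in>G. w x * b i x))) \<or>
         (\<exists>a. (\<forall>x\<in>G. 0 \<le> (\<Sum>i\<in>I. a i * b i x)) \<and> (\<Sum>i\<in>I. a i * y i) < 0)"
  using assms(2)
proof (induction G arbitrary: b y)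
  case empty
  show ?case
  proof (cases "\<forall>i\<in>I. y i = 0")
    case False
    then obtain j where "j \<in> I" "y j \<noteq> 0" by blast
    then have "0 < (\<Sum>i\<in>I. y i * y i)"
      using assms(1) by (intro sum_pos2[of _ j]) (auto simp: zero_less_mult_iff)
    then have "(\<Sum>i\<in>I. (- y i) * y i) < 0"
      by (simp add: sum_negf)
    then show ?thesis by (intro disjI2 exI[of _ "\<lambda>i. - y i"]) simp
  qed simp
next
  case (insert k G)
  note ins = \<open>finite G\<close> \<open>k \<notin> G\<close>
  show ?case
  proof (rule disjCI)
    assume no: "\<not> (\<exists>a. (\<forall>x\<in>insert k G. 0 \<le> (\<Sum>i\<in>I. a i * b i x)) \<and> (\<Sum>i\<in>I. a i * y i) < 0)"
    show "\<exists>w. (\<forall>x\<in>insert k G. 0 \<le> w x) \<and> (\<forall>i\<in>I. y i = (\<Sum>x\<in>insert k G. w x * b i x))"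
    proof (cases "\<exists>w. (\<forall>x\<in>G. 0 \<le> w x) \<and> (\<forall>i\<in>I. y i = (\<Sum>x\<in>G. w x * b i x))")
      case True
      then obtain w where w: "\<forall>x\<in>G. 0 \<le> w x" "\<forall>i\<in>I. y i = (\<Sum>x\<in>G. w x * b i x)" by blast
      have "(\<Sum>x\<in>G. (w(k:=0)) x * b i x) = (\<Sum>x\<in>G. w x * b i x)" for i
        using ins by (intro sum.cong) auto
      then show ?thesis using w ins by (intro exI[of _ "w(k:=0)"]) auto
    next
      case False
      then obtain a0 where a0: "\<forall>x\<in>G. 0 \<le> (\<Sum>i\<in>I. a0 i * b i x)" "(\<Sum>i\<in>I. a0 i * y i) < 0"
        using insert.IH[of y b] by blast
      \<comment> \<open>\<open>a0\<close> separates \<open>y\<close> from the old generators; if it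
        were nonnegative at \<open>k\<close> too, it would contradict \<open>no\<close>. So it is
        negative there, and \<open>h\<close> rescales it to the value -1.\<close>
      define c where "c = - (\<Sum>i\<in>I. a0 i * b i k)"
      have c: "c > 0" using no a0 unfolding c_def by force
      define h where "h i = a0 i / c" for i
      have hs: "(\<Sum>i\<in>I. h i * z i) = (\<Sum>i\<in>I. a0 i * z i) / c" for z :: "'i \<Rightarrow> real"
        by (simp add: h_def sum_divide_distrib)
      have hk: "(\<Sum>i\<in>I. h i * b i k) = -1" using c by (simp add: hs c_def)
      define hb where "hb x = (\<Sum>i\<in>I. h i * b i x)" for x
      define hy where "hy = (\<Sum>i\<in>I. h i * y i)"
      have hb0: "0 \<le> hb x" if "x \<in> G" for x using a0 that c by (simp add: hb_def hs)
      have hy0: "hy < 0" using a0 c by (simp add: hy_def hs divide_neg_pos)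
      \<comment> \<open>Projection along generator \<open>k\<close> onto the kernel of
        \<open>h\<close>. A functional separating the projected data would separate the original
        data once the multiple of \<open>h\<close> that makes it vanish at \<open>k\<close> is
        added.\<close>
      define b' where "b' i x = b i x + hb x * b i k" for i x
      define y' where "y' i = y i + hy * b i k" for i
      have "\<not> (\<exists>a. (\<forall>x\<in>G. 0 \<le> (\<Sum>i\<in>I. a i * b' i x)) \<and> (\<Sum>i\<in>I. a i * y' i) < 0)"
      proof
        assume "\<exists>a. (\<forall>x\<in>G. 0 \<le> (\<Sum>i\<in>I. a i * b' i x)) \<and> (\<Sum>i\<in>I. a i * y' i) < 0"
        then obtain a where a: "\<And>x. x \<in> G \<Longrightarrow> 0 \<le> (\<Sum>i\<in>I. a i * b' i x)" "(\<Sum>i\<in>I. a i * y' i) < 0" by blast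
        define s where "s = (\<Sum>i\<in>I. a i * b i k)"
        define a' where "a' i = a i + s * h i" for i
        have e: "(\<Sum>i\<in>I. a' i * z i) = (\<Sum>i\<in>I. a i * z i) + s * (\<Sum>i\<in>I. h i * z i)" for z :: "'i \<Rightarrow> real"
          by (simp add: a'_def algebra_simps sum.distrib sum_distrib_left)
        have e2: "(\<Sum>i\<in>I. a i * (z i + t * b i k)) = (\<Sum>i\<in>I. a i * z i) + t * s" for z :: "'i \<Rightarrow> real" and t
          by (simp add: s_def algebra_simps sum.distrib sum_distrib_left)
        have "(\<Sum>i\<in>I. a' i * b i k) = 0" using e[of "\<lambda>i. b i k"] hk s_def by simp
        moreover have "0 \<le> (\<Sum>i\<in>I. a' i * b i x)" if "x \<in> G" for x
          using a(1)[OF that] e[of "\<lambda>i. b i x", folded hb_def] e2[of "\<lambda>i. b i x" "hb x"]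
          by (simp only: b'_def mult.commute[of s])
        moreover have "(\<Sum>i\<in>I. a' i * y i) < 0"
          using a(2) e[of y, folded hy_def] e2[of y hy] by (simp only: y'_def mult.commute[of s])
        ultimately show False using no by (metis insert_iff order_refl)
      qed
      then obtain w where w: "\<forall>x\<in>G. 0 \<le> w x" "\<forall>i\<in>I. y' i = (\<Sum>x\<in>G. w x * b' i x)"
        using insert.IH[of y' b'] by blast
      \<comment> \<open>Undoing the projection collects all multiples of generator \<open>k\<close>
        in one weight; it is nonnegative because \<open>hb\<close> is nonnegative on
        \<open>G\<close> and \<open>hy\<close> is negative.\<close>
      define wk where "wk = (\<Sum>x\<in>G. w x * hb x) - hy"
      have "0 \<le> (\<Sum>x\<in>G. w x * hb x)" using w hb0 by (intro sum_nonneg) auto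
      then have "wk \<ge> 0" unfolding wk_def using hy0 by simp
      moreover have "y i = (\<Sum>x\<in>insert k G. (w(k:=wk)) x * b i x)" if "i \<in> I" for i
      proof -
        have "(\<Sum>x\<in>G. (w(k:=wk)) x * b i x) = (\<Sum>x\<in>G. w x * b i x)"
          using ins by (intro sum.cong) auto
        moreover have "y i + hy * b i k = (\<Sum>x\<in>G. w x * b i x) + (\<Sum>x\<in>G. w x * hb x) * b i k"
          using w(2) that by (simp add: b'_def y'_def algebra_simps sum.distrib sum_distrib_left)
        ultimately show ?thesis using ins by (simp add: wk_def algebra_simps)
      qed
      ultimately show ?thesis using w(1) ins by (intro exI[of _ "w(k:=wk)"]) auto
    qed
  qed
qed

text \<open>Tychonoff's theorem for pointwise convergence. It serves for coefficient vectors and for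
  sequences of nodes and weights; the coordinates that carry no information need only stay in a
  compact set.\<close>

lemma compact_PiE_fun:
  fixes S :: "'i \<Rightarrow> 'a::topological_space set"
  assumes "\<And>i. compact (S i)"
  shows "compact {f. \<forall>i. f i \<in> S i}"
proof -
  have "compactin (product_topology (\<lambda>i. euclidean) UNIV) (PiE UNIV S)"
    using assms by (simp add: compactin_PiE)
  then have "compact (PiE UNIV S)"
    by (simp add: euclidean_product_topology)
  moreover have "PiE UNIV S = {f. \<forall>i. f i \<in> S i}" by (auto simp: PiE_def)
  ultimately show ?thesis by simp
qed

text \<open>Farkas' lemma yields the functional for every finite part of \<open>K\<close>; the coefficient vectors can
  be normalized to a compact sphere, so the finite intersection property applies.\<close>

lemma supporting_functional_independent:
  fixes b :: "'i \<Rightarrow> 'a \<Rightarrow> real"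
  assumes fin: "finite I" and e: "e \<in> K"
    and indep: "\<And>a. (\<And>x. x \<in> K \<Longrightarrow> (\<Sum>i\<in>I. a i * b i x) = 0) \<Longrightarrow> \<forall>i\<in>I. a i = 0"
    and nmem: "\<And>\<epsilon>. \<epsilon> > 0 \<Longrightarrow> \<not> cone_mem I b K (\<lambda>i. z i - \<epsilon> * b i e)"
  shows "\<exists>a. (\<forall>x\<in>K. 0 \<le> (\<Sum>i\<in>I. a i * b i x)) \<and> (\<exists>x\<in>K. 0 < (\<Sum>i\<in>I. a i * b i x)) \<and> (\<Sum>i\<in>I. a i * z i) \<le> 0"
proof -
  \<comment> \<open>The cube bounds the coordinates outside \<open>I\<close> as well, for the sake
    of compactness; the norm condition on \<open>I\<close> excludes the zero functional from the
    limit.\<close>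
  define S where "S = {a :: 'i \<Rightarrow> real. \<forall>i. a i \<in> {-1..1}} \<inter> {a. (\<Sum>i\<in>I. \<bar>a i\<bar>) = 1}"
  have cont: "continuous_on UNIV (\<lambda>a::'i \<Rightarrow> real. a i)" for i
    by simp
  have "closed {a :: 'i \<Rightarrow> real. (\<Sum>i\<in>I. \<bar>a i\<bar>) = 1}"
    by (intro closed_Collect_eq continuous_intros cont)
  then have S: "compact S"
    unfolding S_def by (intro compact_Int_closed compact_PiE_fun) auto
  define F :: "'a \<Rightarrow> ('i \<Rightarrow> real) set" where "F x = {a. 0 \<le> (\<Sum>i\<in>I. a i * b i x)}" for x
  define H :: "real \<Rightarrow> ('i \<Rightarrow> real) set" where "H \<epsilon> = {a. (\<Sum>i\<in>I. a i * z i) \<le> \<epsilon> * (\<Sum>i\<in>I. a i * b i e)}" for \<epsilon>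
  have Fc: "closed (F x)" and Hc: "closed (H \<epsilon>)" for x \<epsilon>
    unfolding F_def H_def by (intro closed_Collect_le continuous_intros cont)+
  define CC where "CC = (\<lambda>(x,\<epsilon>). F x \<inter> H \<epsilon>)"
  have "S \<inter> (\<Inter>j\<in>K \<times> {0<..}. CC j) \<noteq> {}"
  proof (rule compact_imp_fip_image[OF S])
    show "closed (CC j)" for j using Fc Hc by (auto simp: CC_def split: prod.splits)
    fix J assume J: "finite J" "J \<subseteq> K \<times> {0::real<..}"
    define \<epsilon> where "\<epsilon> = Min (insert 1 (snd ` J))"
    have \<epsilon>: "\<epsilon> > 0" "\<And>j. j \<in> J \<Longrightarrow> \<epsilon> \<le> snd j" using J unfolding \<epsilon>_def by auto
    \<comment> \<open>With \<open>e\<close> among the generators the functional is nonnegative at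
      \<open>e\<close>, so the condition \<open>H\<close> for the least \<open>\<epsilon>\<close>
      implies it for all larger ones.\<close>
    let ?G = "insert e (fst ` J)"
    have G: "finite ?G" "?G \<subseteq> K" using J e by auto
    have "\<not> (\<exists>w. (\<forall>x\<in>?G. 0 \<le> w x) \<and> (\<forall>i\<in>I. z i - \<epsilon> * b i e = (\<Sum>x\<in>?G. w x * b i x)))"
    proof
      assume "\<exists>w. (\<forall>x\<in>?G. 0 \<le> w x) \<and> (\<forall>i\<in>I. z i - \<epsilon> * b i e = (\<Sum>x\<in>?G. w x * b i x))"
      then have "cone_mem I b K (\<lambda>i. z i - \<epsilon> * b i e)"
        unfolding cone_mem_def using G by blast
      then show False using nmem[OF \<epsilon>(1)] by blast
    qed
    with farkas[OF fin G(1), of "\<lambda>i. z i - \<epsilon> * b i e" b]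
    have "\<exists>a. (\<forall>x\<in>?G. 0 \<le> (\<Sum>i\<in>I. a i * b i x)) \<and> (\<Sum>i\<in>I. a i * (z i - \<epsilon> * b i e)) < 0"
      by (simp only: simp_thms)
    then obtain a where a0: "(\<forall>x\<in>?G. 0 \<le> (\<Sum>i\<in>I. a i * b i x)) \<and> (\<Sum>i\<in>I. a i * (z i - \<epsilon> * b i e)) < 0"
      by (rule exE)
    have a: "\<And>x. x \<in> ?G \<Longrightarrow> 0 \<le> (\<Sum>i\<in>I. a i * b i x)"
      by (rule bspec[OF a0[THEN conjunct1]])
    have a2: "(\<Sum>i\<in>I. a i * (z i - \<epsilon> * b i e)) < 0"
      by (rule a0[THEN conjunct2])
    define N where "N = (\<Sum>i\<in>I. \<bar>a i\<bar>)"
    have "N > 0"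
    proof (rule ccontr)
      assume "\<not> N > 0"
      moreover have "N \<ge> 0" unfolding N_def by (intro sum_nonneg) auto
      ultimately have "N = 0" by simp
      then have "\<forall>i\<in>I. a i = 0" unfolding N_def using fin by (simp add: sum_nonneg_eq_0_iff)
      then show False using a2 by simp
    qed
    define a' where "a' i = (if i \<in> I then a i / N else 0)" for i
    have a's: "(\<Sum>i\<in>I. a' i * t i) = (\<Sum>i\<in>I. a i * t i) / N" for t :: "'i \<Rightarrow> real"
      by (simp add: a'_def sum_divide_distrib)
    have "(\<Sum>i\<in>I. \<bar>a' i\<bar>) = 1" using \<open>N > 0\<close> 
      by (simp add: a'_def N_def[symmetric] sum_divide_distrib[symmetric])
    moreover have "\<bar>a' i\<bar> \<le> 1" for i
    proof (cases "i \<in> I")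
      case True
      then have "\<bar>a' i\<bar> \<le> (\<Sum>i\<in>I. \<bar>a' i\<bar>)" using fin by (intro member_le_sum) auto
      then show ?thesis using \<open>(\<Sum>i\<in>I. \<bar>a' i\<bar>) = 1\<close> by simp
    qed (simp add: a'_def)
    ultimately have "a' \<in> S" unfolding S_def by (auto simp: abs_le_iff minus_le_iff)
    have pos: "0 \<le> (\<Sum>i\<in>I. a' i * b i x)" if "x \<in> ?G" for x
      using a[OF that] \<open>N > 0\<close> by (simp add: a's)
    have H: "(\<Sum>i\<in>I. a' i * z i) \<le> \<epsilon>' * (\<Sum>i\<in>I. a' i * b i e)" if "\<epsilon>' \<ge> \<epsilon>" for \<epsilon>'
    proof -
      have "(\<Sum>i\<in>I. a' i * (z i - \<epsilon> * b i e)) \<le> 0"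
        using a2 \<open>N > 0\<close> by (simp add: a's divide_nonpos_pos)
      then have "(\<Sum>i\<in>I. a' i * z i) \<le> \<epsilon> * (\<Sum>i\<in>I. a' i * b i e)"
        by (simp add: algebra_simps sum_subtractf sum_distrib_left)
      also have "\<dots> \<le> \<epsilon>' * (\<Sum>i\<in>I. a' i * b i e)"
        using pos[of e] that by (intro mult_right_mono) auto
      finally show ?thesis .
    qed
    have "a' \<in> CC j" if "j \<in> J" for j
      using pos[of "fst j"] H[OF \<epsilon>(2)[OF that]] that
      by (simp add: CC_def F_def H_def split_beta)
    with \<open>a' \<in> S\<close> have "a' \<in> S \<inter> (\<Inter>j\<in>J. CC j)" by blast
    then show "S \<inter> (\<Inter>j\<in>J. CC j) \<noteq> {}" by blast
  qed
  then obtain a where a: "a \<in> S" "\<And>x \<epsilon>. x \<in> K \<Longrightarrow> \<epsilon> > 0 \<Longrightarrow> a \<in> F x \<and> a \<in> H \<epsilon>"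
    unfolding CC_def by fastforce
  have 1: "\<forall>x\<in>K. 0 \<le> (\<Sum>i\<in>I. a i * b i x)" using a(2)[of _ 1] by (auto simp: F_def)
  have 2: "\<exists>x\<in>K. 0 < (\<Sum>i\<in>I. a i * b i x)"
  proof (rule ccontr)
    assume "\<not> ?thesis"
    then have "\<And>x. x \<in> K \<Longrightarrow> (\<Sum>i\<in>I. a i * b i x) = 0" using 1 by force
    from indep[OF this] have "(\<Sum>i\<in>I. \<bar>a i\<bar>) = 0" by simp
    with a(1) show False by (simp add: S_def)
  qed
  have "(\<Sum>i\<in>I. a i * z i) \<le> 0"
  proof (rule field_le_epsilon)
    fix d :: real assume d: "d > 0"
    define t where "t = (\<Sum>i\<in>I. a i * b i e)"
    have t: "t \<ge> 0" using 1 e by (simp add: t_def)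
    have "(\<Sum>i\<in>I. a i * z i) \<le> d / (t + 1) * t"
      using a(2)[OF e, of "d / (t+1)"] d t by (auto simp: H_def t_def)
    also have "\<dots> \<le> d" using d t by (simp add: field_simps)
    finally show "(\<Sum>i\<in>I. a i * z i) \<le> 0 + d" by simp
  qed
  with 1 2 show ?thesis by blast
qed

lemma supporting_functional:
  fixes b :: "'i \<Rightarrow> 'a \<Rightarrow> real"
  assumes fin: "finite I" and e: "e \<in> K"
    and resp: "\<And>a. (\<And>x. x \<in> K \<Longrightarrow> (\<Sum>i\<in>I. a i * b i x) = 0) \<Longrightarrow> (\<Sum>i\<in>I. a i * z i) = 0"
    and nmem: "\<And>\<epsilon>. \<epsilon> > 0 \<Longrightarrow> \<not> cone_mem I b K (\<lambda>i. z i - \<epsilon> * b i e)"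
  shows "\<exists>a. (\<forall>x\<in>K. 0 \<le> (\<Sum>i\<in>I. a i * b i x)) \<and> (\<exists>x\<in>K. 0 < (\<Sum>i\<in>I. a i * b i x)) \<and> (\<Sum>i\<in>I. a i * z i) \<le> 0"
  using assms
proof (induction I rule: finite_remove_induct)
  case empty
  have "cone_mem {} b K (\<lambda>i. z i - 1 * b i e)" by (auto simp: cone_mem_def)
  then show ?case using empty(3)[of 1] by simp
next
  case (remove I)
  show ?case
  proof (cases "\<forall>a. (\<forall>x\<in>K. (\<Sum>i\<in>I. a i * b i x) = 0) \<longrightarrow> (\<forall>i\<in>I. a i = 0)")
    case True
    then show ?thesis
      by (intro supporting_functional_independent[OF remove(1) e] remove.prems) auto
  next
    case False
    then obtain a j where a: "\<And>x. x \<in> K \<Longrightarrow> (\<Sum>i\<in>I. a i * b i x) = 0" "j \<in> I" "a j \<noteq> 0" by blast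
    have spl: "(\<Sum>i\<in>I. t i) = t j + (\<Sum>i\<in>I-{j}. t i)" for t :: "'i \<Rightarrow> real"
      using remove(1) a(2) by (simp add: sum.remove)
    have ext: "(\<Sum>i\<in>I. (c(j:=0)) i * t i) = (\<Sum>i\<in>I-{j}. c i * t i)" for c t :: "'i \<Rightarrow> real"
      by (subst spl) (auto intro!: sum.cong)
    have az: "(\<Sum>i\<in>I. a i * z i) = 0" using remove.prems(2) a(1) by blast
    have bj: "b j x = (\<Sum>i\<in>I-{j}. (- a i / a j) * b i x)" if "x \<in> K" for x
    proof -
      have "a j * b j x = (\<Sum>i\<in>I-{j}. - a i * b i x)"
        using a(1)[OF that] by (simp add: spl sum_negf)
      then have "b j x = (\<Sum>i\<in>I-{j}. - a i * b i x) / a j" using a(3) by (simp add: field_simps)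
      then show ?thesis by (simp add: sum_divide_distrib)
    qed
    have zj: "z j = (\<Sum>i\<in>I-{j}. (- a i / a j) * z i)"
    proof -
      have "a j * z j = (\<Sum>i\<in>I-{j}. - a i * z i)"
        using az by (simp add: spl sum_negf)
      then have "z j = (\<Sum>i\<in>I-{j}. - a i * z i) / a j" using a(3) by (simp add: field_simps)
      then show ?thesis by (simp add: sum_divide_distrib)
    qed
    have "\<exists>a. (\<forall>x\<in>K. 0 \<le> (\<Sum>i\<in>I-{j}. a i * b i x)) \<and> (\<exists>x\<in>K. 0 < (\<Sum>i\<in>I-{j}. a i * b i x)) \<and> (\<Sum>i\<in>I-{j}. a i * z i) \<le> 0"
    proof (rule remove.IH[OF a(2) e])
      fix c assume c: "\<And>x. x \<in> K \<Longrightarrow> (\<Sum>i\<in>I-{j}. c i * b i x) = 0"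
      show "(\<Sum>i\<in>I-{j}. c i * z i) = 0"
        using remove.prems(2)[of "c(j:=0)"] c by (simp only: ext)
    next
      fix \<epsilon> :: real assume \<epsilon>: "\<epsilon> > 0"
      show "\<not> cone_mem (I-{j}) b K (\<lambda>i. z i - \<epsilon> * b i e)"
      proof
        assume "cone_mem (I-{j}) b K (\<lambda>i. z i - \<epsilon> * b i e)"
        then obtain P w where P: "finite P" "P \<subseteq> K" "\<forall>x\<in>P. 0 \<le> w x"
          and eq: "\<forall>i\<in>I-{j}. z i - \<epsilon> * b i e = (\<Sum>x\<in>P. w x * b i x)"
          unfolding cone_mem_def by blast
        have "z j - \<epsilon> * b j e = (\<Sum>i\<in>I-{j}. (- a i / a j) * (z i - \<epsilon> * b i e))"
          unfolding zj bj[OF e] sum_distrib_left sum_subtractf[symmetric]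
          by (intro sum.cong) (auto simp: algebra_simps)
        also have "\<dots> = (\<Sum>i\<in>I-{j}. \<Sum>x\<in>P. w x * ((- a i / a j) * b i x))"
          using eq by (intro sum.cong refl) (simp add: sum_distrib_left mult_ac)
        also have "\<dots> = (\<Sum>x\<in>P. \<Sum>i\<in>I-{j}. w x * ((- a i / a j) * b i x))" by (rule sum.swap)
        also have "\<dots> = (\<Sum>x\<in>P. w x * b j x)"
          using P(2) by (intro sum.cong refl) (simp add: bj subset_eq sum_distrib_left)
        finally have "cone_mem I b K (\<lambda>i. z i - \<epsilon> * b i e)"
          using P eq unfolding cone_mem_def by blast
        then show False using remove.prems(3)[OF \<epsilon>] by blast
      qed
    qed
    then obtain c where "\<forall>x\<in>K. 0 \<le> (\<Sum>i\<in>I-{j}. c i * b i x)" "\<exists>x\<in>K. 0 < (\<Sum>i\<in>I-{j}. c i * b i x)" "(\<Sum>i\<in>I-{j}. c i * z i) \<le> 0"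
      by blast
    then show ?thesis by (intro exI[of _ "c(j:=0)"]) (simp only: ext)
  qed
qed

section \<open>Point masses and representations with few nodes\<close>

lemma sum_insert_point_mass:
  fixes w h :: "'a \<Rightarrow> real"
  assumes "finite P"
  shows "(\<Sum>x\<in>insert e P. ((if x \<in> P then w x else 0) + (if x = e then c else 0)) * h x)
    = c * h e + (\<Sum>x\<in>P. w x * h x)"
proof -
  have "(\<Sum>x\<in>insert e P. ((if x \<in> P then w x else 0) + (if x = e then c else 0)) * h x)
      = (\<Sum>x\<in>insert e P. (if x \<in> P then w x * h x else 0)) + (\<Sum>x\<in>insert e P. (if x = e then c * h x else 0))"
    unfolding sum.distrib[symmetric] by (intro sum.cong refl) (simp add: algebra_simps)
  also have "(\<Sum>x\<in>insert e P. (if x \<in> P then w x * h x else 0)) = (\<Sum>x\<in>P. w x * h x)"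
    using assms by (intro sum.mono_neutral_cong_right) auto
  also have "(\<Sum>x\<in>insert e P. (if x = e then c * h x else 0)) = c * h e"
    using assms by (subst sum.delta) auto
  finally show ?thesis by simp
qed

text \<open>Gaussian elimination: each pivot uses up one equation and one unknown, so the surplus of
  unknowns survives to the end.\<close>

lemma homogeneous_system_nontrivial_solution:
  fixes b :: "'i \<Rightarrow> 'a \<Rightarrow> real"
  assumes "finite I" "finite P" "card I < card P"
  shows "\<exists>d. (\<exists>x\<in>P. d x \<noteq> 0) \<and> (\<forall>i\<in>I. (\<Sum>x\<in>P. d x * b i x) = 0)"
  using assms
proof (induction I arbitrary: P b)
  case empty
  then have "P \<noteq> {}" by auto
  then show ?case by (intro exI[of _ "\<lambda>_. 1"]) auto
next
  case (insert k I)
  show ?case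
  proof (cases "\<forall>x\<in>P. b k x = 0")
    case True
    have "card I < card P" using insert by auto
    then obtain d where "\<exists>x\<in>P. d x \<noteq> 0" "\<forall>i\<in>I. (\<Sum>x\<in>P. d x * b i x) = 0"
      using insert.IH[of P b] insert.prems by blast
    then show ?thesis using True by (intro exI[of _ d]) auto
  next
    case False
    then obtain x0 where x0: "x0 \<in> P" "b k x0 \<noteq> 0" by blast
    define P' where "P' = P - {x0}"
    define b' where "b' i x = b i x - b i x0 / b k x0 * b k x" for i x
    have P': "finite P'" "card I < card P'" "x0 \<notin> P'" using insert x0 by (auto simp: P'_def)
    then obtain d where d: "\<exists>x\<in>P'. d x \<noteq> 0" "\<And>i. i \<in> I \<Longrightarrow> (\<Sum>x\<in>P'. d x * b' i x) = 0"
      using insert.IH[of P' b'] by blast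
    define s where "s = (\<Sum>x\<in>P'. d x * b k x)"
    define d' where "d' = d(x0 := - s / b k x0)"
    have *: "(\<Sum>x\<in>P. d' x * b i x) = (\<Sum>x\<in>P'. d x * b i x) - s / b k x0 * b i x0" for i
    proof -
      have "(\<Sum>x\<in>P. d' x * b i x) = d' x0 * b i x0 + (\<Sum>x\<in>P'. d' x * b i x)"
        using insert x0 by (simp add: P'_def sum.remove)
      also have "(\<Sum>x\<in>P'. d' x * b i x) = (\<Sum>x\<in>P'. d x * b i x)"
        using P' by (intro sum.cong) (auto simp: d'_def)
      finally show ?thesis by (simp add: d'_def)
    qed
    have "(\<Sum>x\<in>P. d' x * b i x) = 0" if "i \<in> insert k I" for i
    proof (cases "i = k")
      case True
      then show ?thesis using x0 by (simp add: * s_def)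
    next
      case False
      then have "0 = (\<Sum>x\<in>P'. d x * b' i x)" using d that by simp
      also have "\<dots> = (\<Sum>x\<in>P'. d x * b i x) - b i x0 / b k x0 * s"
        by (simp add: b'_def s_def algebra_simps sum_subtractf sum_distrib_left)
      finally show ?thesis by (simp add: * mult.commute)
    qed
    moreover have "\<exists>x\<in>P. d' x \<noteq> 0" using d(1) P' by (auto simp: d'_def P'_def)
    ultimately show ?thesis by blast
  qed
qed

text \<open>In a representation with fewest points, more points than coordinates would admit a
  linear dependency; subtracting the largest multiple of it that keeps the weights nonnegative
  removes a point. The uniform bound \<open>card I\<close> lets all representations be encoded with
  the same number of slots, which a compactness argument requires.\<close>

lemma conic_caratheodory:
  fixes b :: "'i \<Rightarrow> 'a \<Rightarrow> real"
  assumes I: "finite I" and y: "cone_mem I b K y"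
  obtains P w where "finite P" "P \<subseteq> K" "card P \<le> card I" "\<And>x. x \<in> P \<Longrightarrow> 0 \<le> w x"
    "\<And>i. i \<in> I \<Longrightarrow> y i = (\<Sum>x\<in>P. w x * b i x)"
proof -
  define rep where "rep P w \<longleftrightarrow> finite P \<and> P \<subseteq> K \<and> (\<forall>x\<in>P. 0 \<le> w x) \<and>
     (\<forall>i\<in>I. y i = (\<Sum>x\<in>P. w x * b i x))" for P w
  have "\<exists>n P w. rep P w \<and> card P = n" using y unfolding rep_def cone_mem_def by blast
  define n where "n = (LEAST n. \<exists>P w. rep P w \<and> card P = n)"
  obtain P w where P: "rep P w" "card P = n"
    using LeastI_ex[OF \<open>\<exists>n P w. rep P w \<and> card P = n\<close>] unfolding n_def by blast
  have least: "n \<le> card P'" if "rep P' w'" for P' w'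
    unfolding n_def by (rule Least_le) (use that in blast)
  have "card P \<le> card I"
  proof (rule ccontr)
    assume "\<not> card P \<le> card I"
    then obtain d0 where d0: "\<exists>x\<in>P. d0 x \<noteq> 0" "\<And>i. i \<in> I \<Longrightarrow> (\<Sum>x\<in>P. d0 x * b i x) = 0"
      using homogeneous_system_nontrivial_solution[of I P b] I P(1) unfolding rep_def by auto
    obtain d where d: "\<exists>x\<in>P. d x > 0" "\<And>i. i \<in> I \<Longrightarrow> (\<Sum>x\<in>P. d x * b i x) = 0"
    proof (cases "\<exists>x\<in>P. d0 x > 0")
      case True
      then show ?thesis using that d0 by blast
    next
      case False
      then have "\<exists>x\<in>P. - d0 x > 0" using d0(1) by force
      then show ?thesis using that[of "\<lambda>x. - d0 x"] d0(2) by (simp add: sum_negf)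
    qed
    define Q where "Q = {x\<in>P. d x > 0}"
    have Q: "finite Q" "Q \<noteq> {}" using d(1) P(1) by (auto simp: Q_def rep_def)
    define \<tau> where "\<tau> = Min ((\<lambda>x. w x / d x) ` Q)"
    have "\<tau> \<in> (\<lambda>x. w x / d x) ` Q" unfolding \<tau>_def using Q by (intro Min_in) auto
    then obtain x0 where x0: "x0 \<in> Q" "\<tau> = w x0 / d x0" by (elim imageE)
    have \<tau>le: "\<tau> \<le> w x / d x" if "x \<in> Q" for x
      unfolding \<tau>_def using that Q by auto
    have "\<tau> \<ge> 0" using x0 P(1) by (auto simp: Q_def rep_def)
    have nn: "0 \<le> w x - \<tau> * d x" if "x \<in> P" for x
    proof (cases "d x > 0")
      case True
      then show ?thesis using \<tau>le[of x] that by (simp add: Q_def field_simps)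
    next
      case False
      then have "\<tau> * d x \<le> 0" using \<open>\<tau> \<ge> 0\<close> by (simp add: mult_nonneg_nonpos)
      then show ?thesis using P(1) that unfolding rep_def by force
    qed
    have z: "w x0 - \<tau> * d x0 = 0" using x0 by (auto simp: Q_def)
    have "y i = (\<Sum>x\<in>P-{x0}. (w x - \<tau> * d x) * b i x)" if "i \<in> I" for i
    proof -
      have "y i = (\<Sum>x\<in>P. w x * b i x) - \<tau> * (\<Sum>x\<in>P. d x * b i x)"
        using P(1) d(2) that by (simp add: rep_def)
      also have "\<dots> = (\<Sum>x\<in>P. (w x - \<tau> * d x) * b i x)"
        by (simp add: algebra_simps sum_subtractf sum_distrib_left)
      also have "\<dots> = (\<Sum>x\<in>P-{x0}. (w x - \<tau> * d x) * b i x)"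
        using P(1) x0 z by (intro sum.mono_neutral_right) (auto simp: rep_def Q_def)
      finally show ?thesis .
    qed
    then have "rep (P - {x0}) (\<lambda>x. w x - \<tau> * d x)"
      using nn P(1) by (auto simp: rep_def)
    then have "card P \<le> card (P - {x0})" using least P(2) by simp
    moreover have "card (P - {x0}) < card P"
      using P(1) x0 by (intro card_Diff1_less) (auto simp: rep_def Q_def)
    ultimately show False by simp
  qed
  then show thesis using that[of P w] P(1) unfolding rep_def by auto
qed

text \<open>Remove as much mass at \<open>e\<close> as possible: what is left lies on the boundary of the cone.\<close>

lemma extremal_representation:
  fixes b :: "'i \<Rightarrow> 'a::t2_space \<Rightarrow> real"
  assumes I: "finite I" and i0: "i0 \<in> I" "\<And>x. b i0 x = 1"
    and K: "compact K" and cont: "\<And>i. i \<in> I \<Longrightarrow> continuous_on UNIV (b i)"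
    and e: "e \<in> K" and y: "cone_mem I b K y"
  obtains c P w a where "0 \<le> c" "finite P" "P \<subseteq> K" "\<And>x. x \<in> P \<Longrightarrow> 0 < w x"
    "\<And>i. i \<in> I \<Longrightarrow> y i = c * b i e + (\<Sum>x\<in>P. w x * b i x)"
    "\<And>x. x \<in> K \<Longrightarrow> 0 \<le> (\<Sum>i\<in>I. a i * b i x)" "\<exists>x\<in>K. 0 < (\<Sum>i\<in>I. a i * b i x)"
    "\<And>x. x \<in> P \<Longrightarrow> (\<Sum>i\<in>I. a i * b i x) = 0"
proof -
  define M where "M = card I"
  \<comment> \<open>Since \<open>b i0\<close> is constantly 1, \<open>Y\<close> is the total mass.
    It bounds \<open>c\<close> and every weight, which makes \<open>box\<close> compact.\<close>
  define Y where "Y = y i0"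
  define box where "box = {0..Y} \<times> {t::nat \<Rightarrow> 'a. \<forall>j. t j \<in> K} \<times> {w::nat \<Rightarrow> real. \<forall>j. w j \<in> {0..Y}}"
  define \<Omega> where "\<Omega> = box \<inter> (\<Inter>i\<in>I. {(c,t,w). y i = c * b i e + (\<Sum>j<M. w j * b i (t j))})"
  have box: "compact box"
    unfolding box_def by (intro compact_Times compact_PiE_fun K compact_Icc)
  have "closed {(c,t,w). y i = c * b i e + (\<Sum>j<M. w j * b i (t j))}" if "i \<in> I" for i
  proof -
    have cj: "continuous_on UNIV (\<lambda>x::real \<times> (nat \<Rightarrow> 'a) \<times> (nat \<Rightarrow> real). fst (snd x) j)" for j
      by (rule continuous_on_compose2[OF continuous_on_product_coordinates[of j]])
        (intro continuous_on_fst continuous_on_snd continuous_on_id subset_UNIV)+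
    have ct: "continuous_on UNIV (\<lambda>x::real \<times> (nat \<Rightarrow> 'a) \<times> (nat \<Rightarrow> real). b i (fst (snd x) j))" for j
      by (rule continuous_on_compose2[OF cont[OF that] cj]) auto
    have cw: "continuous_on UNIV (\<lambda>x::real \<times> (nat \<Rightarrow> 'a) \<times> (nat \<Rightarrow> real). snd (snd x) j)" for j
      by (rule continuous_on_compose2[OF continuous_on_product_coordinates[of j]])
        (intro continuous_on_fst continuous_on_snd continuous_on_id subset_UNIV)+
    have "closed {x::real \<times> (nat \<Rightarrow> 'a) \<times> (nat \<Rightarrow> real). y i = fst x * b i e + (\<Sum>j<M. snd (snd x) j * b i (fst (snd x) j))}"
      by (intro closed_Collect_eq continuous_intros ct cw)
    then show ?thesis by (simp add: case_prod_unfold)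
  qed
  then have \<Omega>: "compact \<Omega>" unfolding \<Omega>_def
    by (intro compact_Int_closed box closed_INT) auto
  have mem: "\<exists>t w. (c,t,w) \<in> \<Omega>" if c: "0 \<le> c" and cm: "cone_mem I b K (\<lambda>i. y i - c * b i e)" for c
  proof -
    obtain P w where P: "finite P" "P \<subseteq> K" "card P \<le> card I" "\<And>x. x \<in> P \<Longrightarrow> 0 \<le> w x"
      and eq: "\<And>i. i \<in> I \<Longrightarrow> y i - c * b i e = (\<Sum>x\<in>P. w x * b i x)"
      using conic_caratheodory[OF I cm] by metis
    obtain h where h: "bij_betw h {0..<card P} P" using ex_bij_betw_nat_finite[OF P(1)] by blast
    define t where "t j = (if j < card P then h j else e)" for j
    define u where "u j = (if j < card P then w (h j) else 0)" for j
    have hP: "h j \<in> P" if "j < card P" for j using h that by (auto simp: bij_betw_def)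
    have su: "(\<Sum>j<M. u j * b i (t j)) = (\<Sum>x\<in>P. w x * b i x)" for i
    proof -
      have "(\<Sum>j<M. u j * b i (t j)) = (\<Sum>j\<in>{0..<card P}. w (h j) * b i (h j))"
        using P(3) by (intro sum.mono_neutral_cong_right) (auto simp: M_def u_def t_def)
      also have "\<dots> = (\<Sum>x\<in>P. w x * b i x)" by (rule sum.reindex_bij_betw[OF h])
      finally show ?thesis .
    qed
    have tot: "Y = c + (\<Sum>x\<in>P. w x)" using eq[OF i0(1)] i0(2) by (simp add: Y_def)
    have "c \<le> Y" using tot P(4) sum_nonneg[of P w] by simp
    moreover have "t j \<in> K" for j using hP[of j] P(2) e by (auto simp: t_def)
    moreover have "u j \<ge> 0" for j using hP[of j] P(4) by (auto simp: u_def)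
    moreover have "u j \<le> Y" for j
    proof (cases "j < card P")
      case True
      then have "w (h j) \<le> (\<Sum>x\<in>P. w x)" using hP P(1,4) by (intro member_le_sum) auto
      then show ?thesis using tot c True by (simp add: u_def)
    qed (use \<open>c \<le> Y\<close> c in \<open>simp add: u_def\<close>)
    ultimately have "(c,t,u) \<in> box" using c by (simp add: box_def)
    moreover have "y i = c * b i e + (\<Sum>j<M. u j * b i (t j))" if "i \<in> I" for i
      using eq[OF that] by (simp add: su)
    ultimately show ?thesis unfolding \<Omega>_def by blast
  qed
  have "\<Omega> \<noteq> {}" using mem[of 0] y by auto
  then obtain m where m: "m \<in> \<Omega>" "\<And>x. x \<in> \<Omega> \<Longrightarrow> fst x \<le> fst m"
    using continuous_attains_sup[OF \<Omega> _ continuous_on_fst[OF continuous_on_id]] by blast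
  obtain c t w where ctw: "m = (c,t,w)" by (cases m)
  have c: "0 \<le> c" and t: "\<And>j. t j \<in> K" and w: "\<And>j. 0 \<le> w j"
    and eq: "\<And>i. i \<in> I \<Longrightarrow> y i = c * b i e + (\<Sum>j<M. w j * b i (t j))"
    using m(1) unfolding ctw \<Omega>_def box_def by auto
  define z where "z i = y i - c * b i e" for i
  \<comment> \<open>Back from slots to nodes: empty slots are discarded, so that all weights become
    positive, and slots that share a node are merged.\<close>
  define J where "J = {j. j < M \<and> w j > 0}"
  define P where "P = t ` J"
  define w' where "w' x = (\<Sum>j\<in>{j\<in>J. t j = x}. w j)" for x
  have J: "finite J" by (simp add: J_def)
  have P: "finite P" "P \<subseteq> K" using t by (auto simp: P_def J_def)
  have w'pos: "0 < w' x" if "x \<in> P" for x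
    unfolding w'_def using that J by (intro sum_pos) (auto simp: P_def J_def)
  have z: "z i = (\<Sum>x\<in>P. w' x * b i x)" if "i \<in> I" for i
  proof -
    have "z i = (\<Sum>j<M. w j * b i (t j))" using eq[OF that] by (simp add: z_def)
    also have "\<dots> = (\<Sum>j\<in>J. w j * b i (t j))"
      using w by (intro sum.mono_neutral_right) (auto simp: J_def order_le_less)
    also have "\<dots> = (\<Sum>x\<in>P. \<Sum>j\<in>{j\<in>J. t j = x}. w j * b i (t j))"
      unfolding P_def by (rule sum.image_gen[OF J])
    also have "\<dots> = (\<Sum>x\<in>P. w' x * b i x)"
      by (intro sum.cong refl) (simp add: w'_def sum_distrib_right)
    finally show ?thesis .
  qed
  have lin: "(\<Sum>i\<in>I. a i * z i) = (\<Sum>x\<in>P. w' x * (\<Sum>i\<in>I. a i * b i x))" for a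
  proof -
    have "(\<Sum>i\<in>I. a i * z i) = (\<Sum>i\<in>I. \<Sum>x\<in>P. w' x * (a i * b i x))"
      by (intro sum.cong refl) (simp add: z sum_distrib_left mult_ac)
    also have "\<dots> = (\<Sum>x\<in>P. \<Sum>i\<in>I. w' x * (a i * b i x))" by (rule sum.swap)
    finally show ?thesis by (simp add: sum_distrib_left)
  qed
  have "\<exists>a. (\<forall>x\<in>K. 0 \<le> (\<Sum>i\<in>I. a i * b i x)) \<and> (\<exists>x\<in>K. 0 < (\<Sum>i\<in>I. a i * b i x)) \<and> (\<Sum>i\<in>I. a i * z i) \<le> 0"
  proof (rule supporting_functional[OF I e])
    fix a assume "\<And>x. x \<in> K \<Longrightarrow> (\<Sum>i\<in>I. a i * b i x) = 0"
    then show "(\<Sum>i\<in>I. a i * z i) = 0" using P(2) by (auto simp: lin subset_eq)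
  next
    fix \<epsilon> :: real assume \<epsilon>: "\<epsilon> > 0"
    show "\<not> cone_mem I b K (\<lambda>i. z i - \<epsilon> * b i e)"
    proof
      assume "cone_mem I b K (\<lambda>i. z i - \<epsilon> * b i e)"
      also have "(\<lambda>i. z i - \<epsilon> * b i e) = (\<lambda>i. y i - (c + \<epsilon>) * b i e)"
        by (simp add: z_def algebra_simps)
      finally obtain t' w' where "(c + \<epsilon>, t', w') \<in> \<Omega>" using mem[of "c + \<epsilon>"] c \<epsilon> by auto
      from m(2)[OF this] show False using \<epsilon> by (simp add: ctw)
    qed
  qed
  then obtain a where a: "\<And>x. x \<in> K \<Longrightarrow> 0 \<le> (\<Sum>i\<in>I. a i * b i x)" "\<exists>x\<in>K. 0 < (\<Sum>i\<in>I. a i * b i x)"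
      "(\<Sum>i\<in>I. a i * z i) \<le> 0" by blast
  \<comment> \<open>The functional is nonnegative at every node and its weighted sum over the nodes
    is at most 0, so it vanishes at each of them.\<close>
  have nn: "0 \<le> w' x * (\<Sum>i\<in>I. a i * b i x)" if "x \<in> P" for x
    using w'pos[OF that] a(1) P(2) that by (auto intro!: mult_nonneg_nonneg)
  have "0 \<le> (\<Sum>x\<in>P. w' x * (\<Sum>i\<in>I. a i * b i x))" by (intro sum_nonneg nn)
  then have "(\<Sum>x\<in>P. w' x * (\<Sum>i\<in>I. a i * b i x)) = 0"
    using a(3) unfolding lin by linarith
  then have "w' x * (\<Sum>i\<in>I. a i * b i x) = 0" if "x \<in> P" for x
    using sum_nonneg_eq_0_iff[OF P(1) nn] that by simp
  then have zer: "(\<Sum>i\<in>I. a i * b i x) = 0" if "x \<in> P" for x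
    using w'pos[OF that] that by (metis less_irrefl mult_eq_0_iff)
  have ye: "y i = c * b i e + (\<Sum>x\<in>P. w' x * b i x)" if "i \<in> I" for i
    using z[OF that] by (simp add: z_def)
  show thesis by (rule that[OF c P w'pos ye a(1) a(2) zer])
qed

section \<open>Zariski closure of a parametrized curve\<close>

lemma poly_funs_monomial:
  assumes "\<alpha> \<in> multi_indices k"
  shows "(\<lambda>x. c * mono_fun \<alpha> x) \<in> poly_funs k"
  unfolding poly_funs_def
proof (intro CollectI exI[of _ "\<lambda>\<beta>. if \<beta> = \<alpha> then c else 0"] allI)
  fix x :: "'b ^ 'a"
  show "c * mono_fun \<alpha> x = (\<Sum>\<beta>\<in>multi_indices k. (if \<beta> = \<alpha> then c else 0) * mono_fun \<beta> x)"
    using assms by (simp add: if_distrib[of "\<lambda>a. a * _"] finite_multi_indices cong: if_cong)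
qed

lemma poly_funs_sum:
  assumes "\<And>a. a \<in> A \<Longrightarrow> f a \<in> poly_funs k"
  shows "(\<lambda>x. \<Sum>a\<in>A. f a x) \<in> poly_funs k"
proof -
  have "\<forall>a\<in>A. \<exists>c. \<forall>x. f a x = (\<Sum>\<alpha>\<in>multi_indices k. c \<alpha> * mono_fun \<alpha> x)"
    using assms by (auto simp: poly_funs_def)
  then obtain c where "\<forall>a\<in>A. \<forall>x. f a x = (\<Sum>\<alpha>\<in>multi_indices k. c a \<alpha> * mono_fun \<alpha> x)"
    by (rule bchoice[THEN exE])
  then have "(\<Sum>a\<in>A. f a x) = (\<Sum>\<alpha>\<in>multi_indices k. (\<Sum>a\<in>A. c a \<alpha>) * mono_fun \<alpha> x)" for x
    by (simp add: sum_distrib_right) (rule sum.swap)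
  then show ?thesis by (auto simp: poly_funs_def intro!: exI[of _ "\<lambda>\<alpha>. \<Sum>a\<in>A. c a \<alpha>"])
qed

lemma poly_funs_add:
  assumes "f \<in> poly_funs k" "g \<in> poly_funs k"
  shows "(\<lambda>x. f x + g x) \<in> poly_funs k"
  using poly_funs_sum[of UNIV "\<lambda>b::bool. if b then f else g" k] assms by (simp add: UNIV_bool add.commute)

lemma poly_funs_mono:
  assumes "f \<in> poly_funs j" "j \<le> k"
  shows "f \<in> poly_funs k"
proof -
  obtain c where c: "\<And>x. f x = (\<Sum>\<alpha>\<in>multi_indices j. c \<alpha> * mono_fun \<alpha> x)"
    using assms by (auto simp: poly_funs_def)
  have "(\<lambda>x. \<Sum>\<alpha>\<in>multi_indices j. c \<alpha> * mono_fun \<alpha> x) \<in> poly_funs k"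
    using assms(2) by (intro poly_funs_sum poly_funs_monomial) (auto simp: multi_indices_def)
  moreover have "f = (\<lambda>x. \<Sum>\<alpha>\<in>multi_indices j. c \<alpha> * mono_fun \<alpha> x)" using c by auto
  ultimately show ?thesis by simp
qed

lemma poly_funs_const: "(\<lambda>x. c) \<in> poly_funs k"
  using poly_funs_monomial[of "\<lambda>_. 0" k c] by (simp add: multi_indices_def mono_fun_def)

lemma poly_funs_coord: "(\<lambda>x. x $ i) \<in> poly_funs 1"
proof -
  let ?\<alpha> = "\<lambda>j. if j = i then 1 else 0 :: nat"
  have "mono_fun ?\<alpha> = (\<lambda>x :: 'a ^ 'b. x $ i)"
    by (rule ext) (simp add: mono_fun_def if_distrib[of "power _"] cong: if_cong)
  moreover have "?\<alpha> \<in> multi_indices 1" by (simp add: multi_indices_def)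
  ultimately show ?thesis using poly_funs_monomial[of ?\<alpha> 1 "1::'a"] by simp
qed

lemma poly_funs_mult:
  fixes f g :: "'a::comm_semiring_1 ^ 'n::finite \<Rightarrow> 'a"
  assumes "f \<in> poly_funs j" "g \<in> poly_funs k"
  shows "(\<lambda>x. f x * g x) \<in> poly_funs (j + k)"
proof -
  obtain c where c: "\<And>x. f x = (\<Sum>\<alpha>\<in>multi_indices j. c \<alpha> * mono_fun \<alpha> x)"
    using assms by (auto simp: poly_funs_def)
  obtain d where d: "\<And>x. g x = (\<Sum>\<alpha>\<in>multi_indices k. d \<alpha> * mono_fun \<alpha> x)"
    using assms by (auto simp: poly_funs_def)
  have m: "mono_fun \<alpha> x * mono_fun \<beta> x = mono_fun (\<lambda>i. \<alpha> i + \<beta> i) x" for \<alpha> \<beta> and x :: "'a ^ 'n"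
    by (simp add: mono_fun_def power_add prod.distrib)
  have "(\<lambda>x. f x * g x) = (\<lambda>x. \<Sum>\<alpha>\<in>multi_indices j. \<Sum>\<beta>\<in>multi_indices k. (c \<alpha> * d \<beta>) * mono_fun (\<lambda>i. \<alpha> i + \<beta> i) x)"
    by (simp add: c d sum_product m[symmetric] mult_ac)
  also have "\<dots> \<in> poly_funs (j + k)"
    by (intro poly_funs_sum poly_funs_monomial) (auto simp: multi_indices_def sum.distrib add_mono)
  finally show ?thesis .
qed

text \<open>The degree is forgotten, since the Zariski closure tests functions of every
  degree.\<close>

definition poly_fun :: "(real ^ 'n::finite \<Rightarrow> real) \<Rightarrow> bool" where
  "poly_fun f \<longleftrightarrow> (\<exists>k. f \<in> poly_funs k)"

lemma poly_fun_const: "poly_fun (\<lambda>x. c)"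
  and poly_fun_coord: "poly_fun (\<lambda>x. x $ i)"
  and poly_fun_mult: "poly_fun f \<Longrightarrow> poly_fun g \<Longrightarrow> poly_fun (\<lambda>x. f x * g x)"
  using poly_funs_const poly_funs_coord poly_funs_mult unfolding poly_fun_def by blast+

lemma poly_fun_add: 
  assumes "poly_fun f" "poly_fun g" shows "poly_fun (\<lambda>x. f x + g x)"
proof -
  obtain j k where "f \<in> poly_funs j" "g \<in> poly_funs k" using assms by (auto simp: poly_fun_def)
  then have "(\<lambda>x. f x + g x) \<in> poly_funs (max j k)"
    by (intro poly_funs_add) (auto elim: poly_funs_mono)
  then show ?thesis by (auto simp: poly_fun_def)
qed

lemma poly_fun_diff: 
  assumes "poly_fun f" "poly_fun g" shows "poly_fun (\<lambda>x. f x - g x)"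
  using poly_fun_add[OF assms(1) poly_fun_mult[OF poly_fun_const[of "-1"] assms(2)]] by simp

lemma poly_fun_sum:
  assumes "finite A" "\<And>a. a \<in> A \<Longrightarrow> poly_fun (f a)" shows "poly_fun (\<lambda>x. \<Sum>a\<in>A. f a x)"
  using assms by (induction A rule: finite_induct) (auto intro: poly_fun_const poly_fun_add)

text \<open>The function \<open>f\<close> produced here plays the role of \<open>det (a i j)\<close>: Gaussian elimination without
  division, starting from a matrix that is the identity at \<open>x0\<close>.\<close>

lemma poly_fun_elimination:
  fixes a :: "nat \<Rightarrow> nat \<Rightarrow> real ^ 'n::finite \<Rightarrow> real"
  assumes "\<And>i j. i < N \<Longrightarrow> j < N \<Longrightarrow> poly_fun (a i j)"
    and "\<And>i j. i < N \<Longrightarrow> j < N \<Longrightarrow> a i j x0 = (if i = j then 1 else 0)"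
  shows "\<exists>f. poly_fun f \<and> f x0 = 1 \<and>
    (\<forall>x v. (\<forall>i<N. (\<Sum>j<N. a i j x * v j) = 0) \<longrightarrow> (\<forall>j<N. f x * v j = 0))"
  using assms
proof (induction N arbitrary: a)
  case 0
  show ?case by (intro exI[of _ "\<lambda>x. 1"]) (auto intro: poly_fun_const)
next
  case (Suc N)
  \<comment> \<open>Cross-multiplication with the pivot \<open>a N N\<close> leaves the identity
    matrix at \<open>x0\<close> intact. The additional factor \<open>a N N\<close> in the resulting
    function pays for recovering the last unknown by back substitution.\<close>
  define a' where "a' i j = (\<lambda>x. a N N x * a i j x - a i N x * a N j x)" for i j
  have "\<exists>f. poly_fun f \<and> f x0 = 1 \<and>
    (\<forall>x v. (\<forall>i<N. (\<Sum>j<N. a' i j x * v j) = 0) \<longrightarrow> (\<forall>j<N. f x * v j = 0))"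
    by (rule Suc.IH) (auto simp: a'_def Suc.prems intro!: poly_fun_diff poly_fun_mult Suc.prems)
  then obtain f where f: "poly_fun f" "f x0 = 1"
    "\<And>x v j. (\<And>i. i < N \<Longrightarrow> (\<Sum>j<N. a' i j x * v j) = 0) \<Longrightarrow> j < N \<Longrightarrow> f x * v j = 0" by blast
  have "f x * a N N x * v j = 0"
    if v: "\<forall>i<Suc N. (\<Sum>j<Suc N. a i j x * v j) = 0" and j: "j < Suc N" for x v j
  proof -
    have r: "a i N x * v N = - (\<Sum>j<N. a i j x * v j)" if "i \<le> N" for i
      using v that by (auto simp: add_eq_0_iff less_Suc_eq_le)
    have "(\<Sum>j<N. a' i j x * v j) = 0" if "i < N" for i
    proof -
      have "(\<Sum>j<N. a' i j x * v j) = a N N x * (\<Sum>j<N. a i j x * v j) - a i N x * (\<Sum>j<N. a N j x * v j)"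
        by (simp add: a'_def algebra_simps sum_subtractf sum_distrib_left)
      also have "\<dots> = a N N x * (- (a i N x * v N)) - a i N x * (- (a N N x * v N))"
        using r[of i] r[of N] that by simp
      finally show ?thesis by simp
    qed
    from f(3)[of x v, OF this] have lt: "f x * v j = 0" if "j < N" for j using that by blast
    show ?thesis
    proof (cases "j < N")
      case True
      then show ?thesis using lt[OF True] by auto
    next
      case False
      then have [simp]: "j = N" using j by simp
      have "f x * a N N x * v j = - (\<Sum>j<N. a N j x * (f x * v j))"
        using r[of N] by (simp add: sum_distrib_left mult_ac)
      also have "\<dots> = 0" using lt by (auto intro!: sum.neutral simp del: mult_eq_0_iff)
      finally show ?thesis .
    qed
  qed
  moreover have "poly_fun (\<lambda>x. f x * a N N x)" using f Suc.prems by (intro poly_fun_mult) auto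
  moreover have "f x0 * a N N x0 = 1" using f Suc.prems by simp
  ultimately show ?case by (intro exI[of _ "\<lambda>x. f x * a N N x"]) blast
qed

section \<open>Real polynomials and parametrizations at complex parameters\<close>

abbreviation cpoly :: "real poly \<Rightarrow> complex poly" where
  "cpoly \<equiv> map_poly complex_of_real"

lemma cpoly_add [simp]: "cpoly (p + q) = cpoly p + cpoly q"
  and cpoly_diff [simp]: "cpoly (p - q) = cpoly p - cpoly q"
  and cpoly_smult [simp]: "cpoly (smult c p) = smult (of_real c) (cpoly p)"
  by (simp_all add: poly_eq_iff coeff_map_poly)

lemma cpoly_mult [simp]: "cpoly (p * q) = cpoly p * cpoly q"
  by (induction p) (simp_all add: map_poly_pCons)

lemma poly_cpoly_of_real [simp]: "poly (cpoly p) (of_real t) = of_real (poly p t)"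
  by (induction p) (simp_all add: map_poly_pCons)

lemma poly_cpoly_cnj: "poly (cpoly p) (cnj z) = cnj (poly (cpoly p) z)"
  by (induction p) (simp_all add: map_poly_pCons)

lemma degree_cpoly [simp]: "degree (cpoly p) = degree p"
  by (rule degree_map_poly) simp

lemma cpoly_eq_0_iff [simp]: "cpoly p = 0 \<longleftrightarrow> p = 0"
  by (simp add: map_poly_eq_0_iff)

text \<open>A nonzero combination of least degree divides every \<open>\<psi> i\<close>, because the
  remainders are combinations again. This yields a greatest common divisor together with its Bezout
  coefficients.\<close>

lemma poly_ideal_principal:
  fixes \<psi> :: "'i::finite \<Rightarrow> real poly"
  shows "\<exists>g A. g = (\<Sum>i\<in>UNIV. A i * \<psi> i) \<and> (\<forall>i. g dvd \<psi> i)"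
proof (cases "\<forall>i. \<psi> i = 0")
  case True
  then show ?thesis by (intro exI[of _ 0] exI[of _ "\<lambda>_. 0"]) auto
next
  case False
  then obtain i0 where i0: "\<psi> i0 \<noteq> 0" by blast
  define J where "J = {g. g \<noteq> 0 \<and> (\<exists>A. g = (\<Sum>i\<in>UNIV. A i * \<psi> i))}"
  have single: "(\<Sum>i\<in>UNIV. (if i = i0 then 1 else 0) * \<psi> i) = \<psi> i0" for i0
    by (simp add: if_distrib[of "\<lambda>a. a * _"] cong: if_cong)
  have "\<exists>A. \<psi> i0 = (\<Sum>i\<in>UNIV. A i * \<psi> i)"
    by (rule exI[of _ "\<lambda>i. if i = i0 then 1 else 0"]) (simp only: single)
  then have "\<psi> i0 \<in> J" using i0 by (simp add: J_def)
  define n where "n = (LEAST n. \<exists>g\<in>J. degree g = n)"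
  have "\<exists>n. \<exists>g\<in>J. degree g = n" using \<open>\<psi> i0 \<in> J\<close> by blast
  from LeastI_ex[OF this] obtain g where g: "g \<in> J" "degree g = n" unfolding n_def by blast
  obtain A where A: "g = (\<Sum>i\<in>UNIV. A i * \<psi> i)" "g \<noteq> 0" using g(1) unfolding J_def by blast
  have "g dvd \<psi> i" for i
  proof (rule ccontr)
    assume "\<not> g dvd \<psi> i"
    then have r: "\<psi> i mod g \<noteq> 0" by (simp add: dvd_eq_mod_eq_0)
    define q where "q = \<psi> i div g"
    have qg: "q * g = (\<Sum>j\<in>UNIV. (q * A j) * \<psi> j)"
      unfolding A(1) by (simp only: sum_distrib_left mult.assoc)
    have "\<psi> i mod g = \<psi> i - q * g" by (simp add: minus_div_mult_eq_mod q_def)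
    also have "\<dots> = (\<Sum>j\<in>UNIV. (if j = i then 1 else 0) * \<psi> j) - (\<Sum>j\<in>UNIV. (q * A j) * \<psi> j)"
      by (simp only: single qg)
    also have "\<dots> = (\<Sum>j\<in>UNIV. ((if j = i then 1 else 0) - q * A j) * \<psi> j)"
      by (simp only: sum_subtractf left_diff_distrib)
    finally have "\<exists>A. \<psi> i mod g = (\<Sum>j\<in>UNIV. A j * \<psi> j)"
      by (rule exI[of _ "\<lambda>j. (if j = i then 1 else 0) - q * A j"])
    then have "\<psi> i mod g \<in> J" using r by (simp add: J_def)
    then have "n \<le> degree (\<psi> i mod g)" unfolding n_def by (intro Least_le) blast
    moreover have "degree (\<psi> i mod g) < degree g" using r A(2) degree_mod_less[of g "\<psi> i"] by auto
    ultimately show False using g by simp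
  qed
  then show ?thesis using A by blast
qed

definition param_value :: "real poly \<Rightarrow> ('n::finite \<Rightarrow> real poly) \<Rightarrow> real \<Rightarrow> real ^ 'n" where
  "param_value \<phi>0 \<phi> t = (\<chi> i. poly (\<phi> i) t / poly \<phi>0 t)"

text \<open>The parameter is complex while the point stays real: an isolated real point of the curve
  may be visible only through nonreal parameters.\<close>

definition complex_param :: "real poly \<Rightarrow> ('n::finite \<Rightarrow> real poly) \<Rightarrow> complex \<Rightarrow> real ^ 'n \<Rightarrow> bool" where
  "complex_param \<phi>0 \<phi> z x \<longleftrightarrow> poly (cpoly \<phi>0) z \<noteq> 0 \<and>
     (\<forall>i. poly (cpoly (\<phi> i)) z = of_real (x $ i) * poly (cpoly \<phi>0) z)"

lemma complex_param_of_real: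
  "complex_param \<phi>0 \<phi> (of_real t) x \<longleftrightarrow> poly \<phi>0 t \<noteq> 0 \<and> x = param_value \<phi>0 \<phi> t"
proof -
  have "complex_of_real a = complex_of_real b * complex_of_real c \<longleftrightarrow> a = b * c" for a b c
    by (metis of_real_eq_iff of_real_mult)
  then show ?thesis
    by (auto simp: complex_param_def param_value_def vec_eq_iff field_simps)
qed

lemma complex_param_unique:
  assumes "complex_param \<phi>0 \<phi> z x" "complex_param \<phi>0 \<phi> z y"
  shows "x = y"
  using assms by (auto simp: complex_param_def vec_eq_iff)

lemma complex_param_cnj:
  assumes "complex_param \<phi>0 \<phi> z x"
  shows "complex_param \<phi>0 \<phi> (cnj z) x"
  using assms by (auto simp: complex_param_def poly_cpoly_cnj)

text \<open>All coefficients except the one of \<open>\<psi> i0\<close> are reduced modulo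
  \<open>\<psi> i0\<close>, and the remaining one absorbs the quotients. Its product with
  \<open>\<psi> i0\<close> then has degree at most \<open>2 * m\<close>, and
  \<open>\<psi> i0\<close> has degree exactly \<open>m\<close>. The condition on \<open>i0\<close>
  excludes a common zero at infinity.\<close>

lemma bezout_degree_bound:
  fixes \<psi> :: "'i::finite \<Rightarrow> real poly"
  assumes A: "(\<Sum>i\<in>UNIV. A i * \<psi> i) = 1" and deg: "\<And>i. degree (\<psi> i) \<le> m"
    and i0: "coeff (\<psi> i0) m \<noteq> 0" and P: "degree P \<le> 2 * m"
  shows "\<exists>B. P = (\<Sum>i\<in>UNIV. B i * \<psi> i) \<and> (\<forall>i. degree (B i) \<le> m)"
proof -
  have dm: "degree (\<psi> i0) = m" using deg[of i0] le_degree[OF i0] by simp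
  have n0: "\<psi> i0 \<noteq> 0" using i0 by auto
  define R where "R = UNIV - {i0}"
  define B0 where "B0 = P * A i0 + (\<Sum>i\<in>R. ((P * A i) div \<psi> i0) * \<psi> i)"
  define B where "B i = (if i = i0 then B0 else (P * A i) mod \<psi> i0)" for i
  have spl: "(\<Sum>i\<in>UNIV. h i) = h i0 + (\<Sum>i\<in>R. h i)" for h :: "'i \<Rightarrow> real poly"
    by (simp add: R_def sum.remove)
  have BR: "(\<Sum>i\<in>R. B i * \<psi> i) = (\<Sum>i\<in>R. ((P * A i) mod \<psi> i0) * \<psi> i)"
    by (intro sum.cong) (auto simp: B_def R_def)
  have dB: "degree (B i) \<le> m" if "i \<noteq> i0" for i
    using degree_mod_less[OF n0, of "P * A i"] that dm by (auto simp: B_def)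
  have "(\<Sum>i\<in>UNIV. B i * \<psi> i) = B0 * \<psi> i0 + (\<Sum>i\<in>R. ((P * A i) mod \<psi> i0) * \<psi> i)"
    by (subst spl) (simp add: BR, simp add: B_def)
  also have "\<dots> = P * (A i0 * \<psi> i0) + (\<Sum>i\<in>R. ((P * A i) div \<psi> i0) * \<psi> i0 * \<psi> i + ((P * A i) mod \<psi> i0) * \<psi> i)"
    by (simp add: B0_def algebra_simps sum.distrib sum_distrib_left)
  also have "(\<Sum>i\<in>R. ((P * A i) div \<psi> i0) * \<psi> i0 * \<psi> i + ((P * A i) mod \<psi> i0) * \<psi> i) = (\<Sum>i\<in>R. P * (A i * \<psi> i))"
    by (intro sum.cong refl trans[OF _ mult.assoc]) (simp only: distrib_right[symmetric] div_mult_mod_eq)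
  also have "P * (A i0 * \<psi> i0) + (\<Sum>i\<in>R. P * (A i * \<psi> i)) = P * (\<Sum>i\<in>UNIV. A i * \<psi> i)"
    by (simp only: spl sum_distrib_left distrib_left)
  finally have sum: "P = (\<Sum>i\<in>UNIV. B i * \<psi> i)" using A by simp
  have "B0 * \<psi> i0 = P - (\<Sum>i\<in>R. B i * \<psi> i)" by (subst sum, subst spl) (simp add: B_def)
  also have "degree \<dots> \<le> 2 * m"
  proof (intro degree_diff_le P degree_sum_le)
    fix i assume "i \<in> R"
    then have "degree (B i * \<psi> i) \<le> m + m"
      using degree_mult_le[of "B i" "\<psi> i"] dB[of i] deg[of i] by (auto simp: R_def)
    then show "degree (B i * \<psi> i) \<le> 2 * m" by simp
  qed (simp add: R_def)
  finally have "degree (B0 * \<psi> i0) \<le> 2 * m" .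
  then have "degree B0 \<le> m"
    using n0 dm by (cases "B0 = 0") (auto simp: degree_mult_eq)
  then have "degree (B i) \<le> m" for i using dB[of i] by (cases "i = i0") (auto simp: B_def)
  with sum show ?thesis by blast
qed

lemma poly_eq_sum_lessThan:
  fixes p :: "'a::comm_semiring_1 poly"
  assumes "degree p < N"
  shows "poly p t = (\<Sum>j<N. coeff p j * t ^ j)"
  unfolding poly_altdef using assms
  by (intro sum.mono_neutral_left) (auto simp: coeff_eq_0 not_le)

text \<open>The second alternative says that \<open>x\<close> is the point at infinity of the parametrization. If both
  fail, the forms \<open>\<phi>\<^sub>i - x\<^sub>i \<phi>\<^sub>0\<close> have no common zero on the projective line, so by Bezout the vector
  \<open>(1, t, \<dots>, t\<^bsup>2m\<^esup>)\<close> is in the kernel of a matrix that depends polynomially on the curve point and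
  is the identity at \<open>x\<close>.\<close>

lemma zariski_closure_param_image_points:
  fixes x :: "real ^ 'n::finite"
  assumes cop: "\<And>z. poly (cpoly \<phi>0) z = 0 \<Longrightarrow> \<exists>i. poly (cpoly (\<phi> i)) z \<noteq> 0"
    and deg: "degree \<phi>0 \<le> m" "\<And>i. degree (\<phi> i) \<le> m"
    and x: "x \<in> zariski_closure (param_image \<phi>0 \<phi>)"
  shows "(\<exists>z. complex_param \<phi>0 \<phi> z x) \<or> (\<forall>i. coeff (\<phi> i) m = x $ i * coeff \<phi>0 m)"
proof (rule ccontr)
  assume neg: "\<not> ?thesis"
  define \<psi> where "\<psi> i = \<phi> i - smult (x $ i) \<phi>0" for i
  have nz: "\<exists>i. poly (cpoly (\<psi> i)) z \<noteq> 0" for z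
    using neg cop[of z] by (cases "poly (cpoly \<phi>0) z = 0") (auto simp: \<psi>_def complex_param_def)
  obtain i0 where i0: "coeff (\<psi> i0) m \<noteq> 0" using neg by (auto simp: \<psi>_def)
  have deg\<psi>: "degree (\<psi> i) \<le> m" for i
    unfolding \<psi>_def using deg by (intro degree_diff_le order_trans[OF degree_smult_le]) auto
  obtain g A where g: "g = (\<Sum>i\<in>UNIV. A i * \<psi> i)" "\<And>i. g dvd \<psi> i"
    using poly_ideal_principal[of \<psi>] by blast
  have "g \<noteq> 0" using g(2)[of i0] i0 by auto
  have "degree g = 0"
  proof (rule ccontr)
    assume "degree g \<noteq> 0"
    then have "\<not> constant (poly (cpoly g))" by (simp add: constant_degree)
    then obtain z where z: "poly (cpoly g) z = 0" using fundamental_theorem_of_algebra by blast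
    obtain i where i: "poly (cpoly (\<psi> i)) z \<noteq> 0" using nz by blast
    obtain q where "\<psi> i = g * q" using g(2)[of i] by (elim dvdE)
    then show False using z i by simp
  qed
  then obtain c where c: "g = [:c:]" by (rule degree_eq_zeroE)
  have "c \<noteq> 0" using c \<open>g \<noteq> 0\<close> by simp
  have "(\<Sum>i\<in>UNIV. smult (inverse c) (A i) * \<psi> i) = [:inverse c:] * g"
    unfolding g(1) sum_distrib_left by simp
  also have "\<dots> = 1" using \<open>c \<noteq> 0\<close> by (simp add: c one_pCons)
  finally have bez: "(\<Sum>i\<in>UNIV. smult (inverse c) (A i) * \<psi> i) = 1" .
  have "\<exists>B. monom 1 l = (\<Sum>i\<in>UNIV. B i * \<psi> i) \<and> (\<forall>i. degree (B i) \<le> m)" if "l < 2 * m + 1" for l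
    using that by (intro bezout_degree_bound[OF bez deg\<psi> i0]) (simp add: degree_monom_eq)
  then obtain B where B: "\<And>l. l < 2 * m + 1 \<Longrightarrow> monom 1 l = (\<Sum>i\<in>UNIV. B l i * \<psi> i)"
    "\<And>l i. l < 2 * m + 1 \<Longrightarrow> degree (B l i) \<le> m" by metis
  \<comment> \<open>Row \<open>l\<close> lists the coefficients of the polynomial \<open>t^l\<close>
    minus the sum of the \<open>(y $ i - x $ i) * \<phi>0 * B l i\<close>. At a point
    \<open>y\<close> with parameter \<open>t\<close> one has
    \<open>(y $ i - x $ i) * \<phi>0(t) = \<psi> i(t)\<close>, so the row annihilates the powers of
    \<open>t\<close>. The degree bound on \<open>B l i\<close> makes the matrix square.\<close>
  define a where "a l j = (\<lambda>y::real^'n. (if l = j then 1 else 0) - (\<Sum>i\<in>UNIV. (y $ i - x $ i) * coeff (\<phi>0 * B l i) j))" for l j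
  have "poly_fun (a l j)" for l j unfolding a_def
    by (intro poly_fun_diff poly_fun_const poly_fun_sum poly_fun_mult poly_fun_coord) simp
  then obtain f where f: "poly_fun f" "f x = 1"
    "\<And>y v. (\<And>l. l < 2 * m + 1 \<Longrightarrow> (\<Sum>j<2 * m + 1. a l j y * v j) = 0) \<Longrightarrow> \<forall>j<2 * m + 1. f y * v j = 0"
    using poly_fun_elimination[of "2 * m + 1" a x] by (auto simp: a_def)
  have "f y = 0" if ymem: "y \<in> param_image \<phi>0 \<phi>" for y
  proof -
    obtain t where t: "poly \<phi>0 t \<noteq> 0" and "y = (\<chi> i. poly (\<phi> i) t / poly \<phi>0 t)"
      using ymem unfolding param_image_def by blast
    then have y: "y $ i = poly (\<phi> i) t / poly \<phi>0 t" for i by simp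
    have "(\<Sum>j<2 * m + 1. a l j y * t ^ j) = 0" if l: "l < 2 * m + 1" for l
    proof -
      have dl: "degree (\<phi>0 * B l i) < 2 * m + 1" for i
        using degree_mult_le[of \<phi>0 "B l i"] deg(1) B(2)[OF l, of i] by linarith
      have "(\<Sum>j<2 * m + 1. a l j y * t ^ j) = (\<Sum>j<2 * m + 1. (if l = j then 1 else 0) * t ^ j)
          - (\<Sum>j<2 * m + 1. \<Sum>i\<in>UNIV. (y $ i - x $ i) * (coeff (\<phi>0 * B l i) j * t ^ j))"
        unfolding a_def by (simp only: left_diff_distrib sum_subtractf sum_distrib_right mult.assoc)
      also have "(\<Sum>j<2 * m + 1. (if l = j then 1 else 0) * t ^ j) = t ^ l"
        using l by (simp add: if_distrib[of "\<lambda>a. a * _"] cong: if_cong)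
      also have "(\<Sum>j<2 * m + 1. \<Sum>i\<in>UNIV. (y $ i - x $ i) * (coeff (\<phi>0 * B l i) j * t ^ j)) =
          (\<Sum>i\<in>UNIV. (y $ i - x $ i) * poly (\<phi>0 * B l i) t)"
        by (subst sum.swap) (simp only: poly_eq_sum_lessThan[OF dl] sum_distrib_left)
      also have "\<dots> = (\<Sum>i\<in>UNIV. poly (B l i * \<psi> i) t)"
        using t by (intro sum.cong refl) (simp add: y \<psi>_def field_simps)
      also have "\<dots> = poly (monom 1 l) t" using B(1)[OF l] by (simp add: poly_sum)
      finally show ?thesis by (simp add: poly_monom)
    qed
    then have "\<forall>j<2 * m + 1. f y * t ^ j = 0" by (rule f(3))
    \<comment> \<open>The entry of the kernel vector at 0 is \<open>t ^ 0 = 1\<close>, so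
      \<open>f\<close> itself vanishes on the image.\<close>
    from this[rule_format, of 0] show ?thesis by simp
  qed
  moreover obtain k where "f \<in> poly_funs k" using f(1) by (auto simp: poly_fun_def)
  ultimately have "f x = 0" using x unfolding zariski_closure_def by auto
  with f(2) show False by simp
qed

section \<open>Zeros of nonnegative functions on the curve\<close>

lemma cpoly_power [simp]: "cpoly (p ^ n) = cpoly p ^ n"
  by (induction n) simp_all

lemma cpoly_sum: "cpoly (\<Sum>a\<in>A. f a) = (\<Sum>a\<in>A. cpoly (f a))"
  by (induction A rule: infinite_finite_induct) simp_all

lemma cpoly_prod: "cpoly (\<Prod>a\<in>A. f a) = (\<Prod>a\<in>A. cpoly (f a))"
  by (induction A rule: infinite_finite_induct) simp_all

lemma cpoly_pderiv: "pderiv (cpoly p) = cpoly (pderiv p)"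
  by (simp add: poly_eq_iff coeff_pderiv coeff_map_poly)

text \<open>Homogenization: every monomial is filled up with powers of \<open>\<phi>0\<close> to
  total degree \<open>k\<close>, which clears the denominators. Because the identity holds at
  complex parameters, a single \<open>F\<close> serves real branches and isolated points
  alike.\<close>

lemma poly_funs_pullback:
  fixes \<phi> :: "'n::finite \<Rightarrow> real poly"
  assumes f: "f \<in> poly_funs k" and deg: "degree \<phi>0 \<le> m" "\<And>i. degree (\<phi> i) \<le> m"
  obtains F where "degree F \<le> k * m"
    "\<And>z x. complex_param \<phi>0 \<phi> z x \<Longrightarrow> poly (cpoly F) z = of_real (f x) * poly (cpoly \<phi>0) z ^ k"
proof -
  obtain c where c: "\<And>x. f x = (\<Sum>\<alpha>\<in>multi_indices k. c \<alpha> * mono_fun \<alpha> x)"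
    using f by (auto simp: poly_funs_def)
  define G where "G \<alpha> = smult (c \<alpha>) (\<phi>0 ^ (k - (\<Sum>i\<in>UNIV. \<alpha> i)) * (\<Prod>i\<in>UNIV. \<phi> i ^ \<alpha> i))" for \<alpha>
  define F where "F = (\<Sum>\<alpha>\<in>multi_indices k. G \<alpha>)"
  have dG: "degree (G \<alpha>) \<le> k * m" if "\<alpha> \<in> multi_indices k" for \<alpha>
  proof -
    have le: "(\<Sum>i\<in>UNIV. \<alpha> i) \<le> k" using that by (simp add: multi_indices_def)
    have "degree (\<Prod>i\<in>UNIV. \<phi> i ^ \<alpha> i) \<le> (\<Sum>i\<in>UNIV. degree (\<phi> i ^ \<alpha> i))"
      using degree_prod_sum_le[of UNIV "\<lambda>i. \<phi> i ^ \<alpha> i"] by (simp add: o_def)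
    also have "\<dots> \<le> (\<Sum>i\<in>UNIV. \<alpha> i * m)"
    proof (rule sum_mono)
      fix i
      have "degree (\<phi> i ^ \<alpha> i) \<le> degree (\<phi> i) * \<alpha> i" by (rule degree_power_le)
      also have "\<dots> \<le> \<alpha> i * m" using deg(2)[of i] by (simp add: mult.commute)
      finally show "degree (\<phi> i ^ \<alpha> i) \<le> \<alpha> i * m" .
    qed
    also have "\<dots> = (\<Sum>i\<in>UNIV. \<alpha> i) * m" by (simp add: sum_distrib_right)
    finally have 1: "degree (\<Prod>i\<in>UNIV. \<phi> i ^ \<alpha> i) \<le> (\<Sum>i\<in>UNIV. \<alpha> i) * m" .
    have "degree (\<phi>0 ^ (k - (\<Sum>i\<in>UNIV. \<alpha> i))) \<le> degree \<phi>0 * (k - (\<Sum>i\<in>UNIV. \<alpha> i))" by (rule degree_power_le)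
    also have "\<dots> \<le> (k - (\<Sum>i\<in>UNIV. \<alpha> i)) * m" using deg(1) by (simp add: mult.commute)
    finally have "degree (\<phi>0 ^ (k - (\<Sum>i\<in>UNIV. \<alpha> i)) * (\<Prod>i\<in>UNIV. \<phi> i ^ \<alpha> i))
        \<le> (k - (\<Sum>i\<in>UNIV. \<alpha> i)) * m + (\<Sum>i\<in>UNIV. \<alpha> i) * m"
      using 1 degree_mult_le add_mono order_trans by blast
    also have "\<dots> = k * m" using le by (simp add: add_mult_distrib[symmetric])
    finally show ?thesis unfolding G_def by (rule order_trans[OF degree_smult_le])
  qed
  have "degree F \<le> k * m"
    unfolding F_def by (rule degree_sum_le) (auto simp: finite_multi_indices dG)
  moreover have "poly (cpoly F) z = of_real (f x) * poly (cpoly \<phi>0) z ^ k" if zx: "complex_param \<phi>0 \<phi> z x" for z x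
  proof -
    let ?w = "poly (cpoly \<phi>0) z"
    have "poly (cpoly (G \<alpha>)) z = of_real (c \<alpha> * mono_fun \<alpha> x) * ?w ^ k" if "\<alpha> \<in> multi_indices k" for \<alpha>
    proof -
      have le: "(\<Sum>i\<in>UNIV. \<alpha> i) \<le> k" using that by (simp add: multi_indices_def)
      have "(\<Prod>i\<in>UNIV. poly (cpoly (\<phi> i)) z ^ \<alpha> i) = (\<Prod>i\<in>UNIV. of_real (x $ i) ^ \<alpha> i) * ?w ^ (\<Sum>i\<in>UNIV. \<alpha> i)"
        using zx by (simp add: complex_param_def power_mult_distrib prod.distrib power_sum)
      moreover have "?w ^ (k - (\<Sum>i\<in>UNIV. \<alpha> i)) * ?w ^ (\<Sum>i\<in>UNIV. \<alpha> i) = ?w ^ k"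
        using le by (simp flip: power_add)
      ultimately show ?thesis
        by (simp add: G_def cpoly_prod poly_prod mono_fun_def mult_ac)
    qed
    then show ?thesis by (simp add: F_def cpoly_sum poly_sum c sum_distrib_right)
  qed
  ultimately show thesis by (rule that)
qed

lemma order_ge_2:
  fixes p :: "'a::field_char_0 poly"
  assumes "p \<noteq> 0" "poly p a = 0" "poly (pderiv p) a = 0"
  shows "2 \<le> order a p"
proof -
  have "pderiv p \<noteq> 0"
  proof
    assume "pderiv p = 0"
    then obtain c where "p = [:c:]" by (metis pderiv_eq_0_iff degree_eq_zeroE)
    then show False using assms by simp
  qed
  have "order a p = Suc (order a (pderiv p))" using assms(1,2) by (rule order_pderiv)
  moreover have "order a (pderiv p) \<noteq> 0" using \<open>pderiv p \<noteq> 0\<close> assms(3) by (simp add: order_root)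
  ultimately show ?thesis by simp
qed

text \<open>Zeros are counted with multiplicity over the complex numbers. \<open>ZZ\<close> keeps
  \<open>Z\<close> disjoint from its conjugate, so that each of its elements accounts for two
  zeros.\<close>

lemma real_poly_zero_count:
  fixes F :: "real poly"
  assumes F: "F \<noteq> 0" and fin: "finite S" "finite E" "finite Z"
    and S: "\<And>t. t \<in> S \<Longrightarrow> poly F t = 0 \<and> poly (pderiv F) t = 0"
    and E: "\<And>t. t \<in> E \<Longrightarrow> poly F t = 0" and SE: "S \<inter> E = {}"
    and Z: "\<And>z. z \<in> Z \<Longrightarrow> poly (cpoly F) z = 0 \<and> Im z \<noteq> 0"
    and ZZ: "\<And>z w. z \<in> Z \<Longrightarrow> w \<in> Z \<Longrightarrow> z \<noteq> cnj w"
  shows "2 * card S + card E + 2 * card Z \<le> degree F"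
proof -
  let ?G = "cpoly F"
  let ?S = "complex_of_real ` S" and ?E = "complex_of_real ` E" and ?Z = "cnj ` Z"
  define R where "R = {z. poly ?G z = 0}"
  have G: "?G \<noteq> 0" using F by simp
  have R: "finite R" unfolding R_def by (rule poly_roots_finite[OF G])
  have o1: "1 \<le> order z ?G" if "z \<in> R" for z
    using that G by (simp add: R_def order_root Suc_le_eq)
  have o2: "2 \<le> order z ?G" if "z \<in> ?S" for z
    using that S G by (auto intro!: order_ge_2 simp: cpoly_pderiv)
  have sub: "?S \<subseteq> R" "?E \<subseteq> R" "Z \<subseteq> R" "?Z \<subseteq> R"
    using S E Z by (auto simp: R_def poly_cpoly_cnj)
  have dis: "?S \<inter> ?E = {}" "(?S \<union> ?E) \<inter> Z = {}" "(?S \<union> ?E \<union> Z) \<inter> ?Z = {}"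
  proof -
    have "Im z = 0" if "z \<in> ?S \<union> ?E" for z using that by auto
    moreover have "Im z \<noteq> 0" if "z \<in> Z \<union> ?Z" for z using that Z by auto
    moreover have "Z \<inter> ?Z = {}" using ZZ by blast
    ultimately show "(?S \<union> ?E) \<inter> Z = {}" "(?S \<union> ?E \<union> Z) \<inter> ?Z = {}" by blast+
    show "?S \<inter> ?E = {}" using SE by auto
  qed
  have c: "card ?S = card S" "card ?E = card E" "card ?Z = card Z"
    by (auto intro!: card_image inj_onI)
  have "2 * card S + card E + 2 * card Z = (\<Sum>z\<in>?S. 2) + (\<Sum>z\<in>?E. 1) + (\<Sum>z\<in>Z. 1) + (\<Sum>z\<in>?Z. 1)"
    using c by simp
  also have "\<dots> \<le> (\<Sum>z\<in>?S. order z ?G) + (\<Sum>z\<in>?E. order z ?G) + (\<Sum>z\<in>Z. order z ?G) + (\<Sum>z\<in>?Z. order z ?G)"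
    using sub by (intro add_mono sum_mono o1 o2) auto
  also have "\<dots> = (\<Sum>z\<in>?S \<union> ?E \<union> Z \<union> ?Z. order z ?G)"
    using fin dis by (simp add: sum.union_disjoint)
  also have "\<dots> \<le> (\<Sum>z\<in>R. order z ?G)"
    using R sub by (intro sum_mono2) auto
  also have "\<dots> \<le> degree ?G" unfolding R_def by (rule sum_order_le_degree[OF G])
  finally show ?thesis by simp
qed

text \<open>At a zero with parameter in the interior of \<open>T\<close> the pullback has a local
  minimum, hence a double zero. Only parameters in \<open>B\<close> may be simple zeros; each of
  them falls short by one, which is the last summand of the bound.\<close>

lemma card_zeros_nonneg_poly_fun:
  fixes \<psi> :: "'n::finite \<Rightarrow> real poly"
  assumes f: "f \<in> poly_funs (2 * s)" and deg: "degree \<psi>0 \<le> m" "\<And>i. degree (\<psi> i) \<le> m"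
    and T0: "\<And>t. t \<in> T \<Longrightarrow> poly \<psi>0 t \<noteq> 0"
    and fin: "finite B"
    and int: "\<And>t. t \<in> T - B \<Longrightarrow> \<exists>\<epsilon>>0. ball t \<epsilon> \<subseteq> T"
    and Y: "\<And>x. x \<in> Y \<Longrightarrow> \<exists>z. Im z \<noteq> 0 \<and> complex_param \<psi>0 \<psi> z x"
    and nonneg: "\<And>t. t \<in> T \<Longrightarrow> 0 \<le> f (param_value \<psi>0 \<psi> t)"
    and nz: "\<exists>x \<in> param_value \<psi>0 \<psi> ` T \<union> Y. f x \<noteq> 0"
    and P: "finite P" "P \<subseteq> param_value \<psi>0 \<psi> ` T \<union> Y" "\<And>x. x \<in> P \<Longrightarrow> f x = 0"
  shows "2 * card P \<le> 2 * s * m + card {t\<in>B. param_value \<psi>0 \<psi> t \<in> P}"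
proof -
  let ?\<gamma> = "param_value \<psi>0 \<psi>"
  obtain F where dF: "degree F \<le> 2 * s * m"
    and F: "\<And>z x. complex_param \<psi>0 \<psi> z x \<Longrightarrow> poly (cpoly F) z = of_real (f x) * poly (cpoly \<psi>0) z ^ (2 * s)"
    by (rule poly_funs_pullback[where \<phi> = \<psi>, OF f deg]) (rule that)
  have par: "complex_param \<psi>0 \<psi> (of_real t) (?\<gamma> t)" if "t \<in> T" for t
    using T0[OF that] by (simp add: complex_param_of_real)
  have Fr: "poly F t = f (?\<gamma> t) * poly \<psi>0 t ^ (2 * s)" if "t \<in> T" for t
    using F[OF par[OF that]] by (simp flip: of_real_power of_real_mult)
  have "\<exists>z. complex_param \<psi>0 \<psi> z x" if "x \<in> ?\<gamma> ` T \<union> Y" for x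
    using that par Y by blast
  then have F0: "F \<noteq> 0" using nz F by (fastforce simp: complex_param_def)
  define P1 where "P1 = P \<inter> ?\<gamma> ` T"
  define P2 where "P2 = P - ?\<gamma> ` T"
  \<comment> \<open>At a singular point several parameters give the same node; one is chosen. The
    choice is injective since a parameter determines its point.\<close>
  have "\<forall>x\<in>P1. \<exists>t. t \<in> T \<and> ?\<gamma> t = x" by (auto simp: P1_def)
  then obtain \<tau> where \<tau>: "\<And>x. x \<in> P1 \<Longrightarrow> \<tau> x \<in> T \<and> ?\<gamma> (\<tau> x) = x" by (metis (no_types))
  have "\<forall>x\<in>P2. \<exists>z. Im z \<noteq> 0 \<and> complex_param \<psi>0 \<psi> z x" using P(2) Y by (auto simp: P2_def)
  then obtain \<zeta> where \<zeta>: "\<And>x. x \<in> P2 \<Longrightarrow> Im (\<zeta> x) \<noteq> 0 \<and> complex_param \<psi>0 \<psi> (\<zeta> x) x" by (metis (no_types))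
  have inj\<tau>: "inj_on \<tau> P1" by (rule inj_onI) (metis \<tau>)
  have inj\<zeta>: "inj_on \<zeta> P2" by (rule inj_onI) (metis \<zeta> complex_param_unique)
  have zero: "f x = 0" if "x \<in> P1 \<or> x \<in> P2" for x using that P(3) by (auto simp: P1_def P2_def)
  define S where "S = \<tau> ` P1 - B"
  define E where "E = \<tau> ` P1 \<inter> B"
  have finP: "finite P1" "finite P2" using P(1) by (auto simp: P1_def P2_def)
  have \<tau>0: "poly F t = 0" "t \<in> T" if "t \<in> \<tau> ` P1" for t
    using that \<tau> zero Fr by auto
  have "2 * card S + card E + 2 * card (\<zeta> ` P2) \<le> degree F"
  proof (rule real_poly_zero_count[OF F0])
    fix t assume t: "t \<in> S"
    then obtain \<epsilon> where \<epsilon>: "\<epsilon> > 0" "ball t \<epsilon> \<subseteq> T" using int[of t] \<tau>0 by (auto simp: S_def)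
    \<comment> \<open>The exponent \<open>2 * s\<close> of \<open>\<psi>0\<close> is even, so
      \<open>F\<close> inherits nonnegativity from \<open>f\<close> on \<open>T\<close>.\<close>
    have "poly F t \<le> poly F u" if "\<bar>t - u\<bar> < \<epsilon>" for u
    proof -
      have "u \<in> T" using that \<epsilon>(2) by (auto simp: dist_real_def)
      then show ?thesis using \<tau>0(1)[of t] t nonneg[of u] Fr[of u] by (simp add: S_def)
    qed
    then have "poly (pderiv F) t = 0"
      using DERIV_local_min[OF poly_DERIV \<epsilon>(1)] by blast
    then show "poly F t = 0 \<and> poly (pderiv F) t = 0" using \<tau>0(1)[of t] t by (simp add: S_def)
  next
    fix z assume "z \<in> \<zeta> ` P2"
    then obtain x where x: "x \<in> P2" "z = \<zeta> x" by blast
    then show "poly (cpoly F) z = 0 \<and> Im z \<noteq> 0" using \<zeta>[of x] F[of z x] zero[of x] by simp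
  next
    fix z w assume "z \<in> \<zeta> ` P2" "w \<in> \<zeta> ` P2"
    then obtain x y where xy: "x \<in> P2" "y \<in> P2" "z = \<zeta> x" "w = \<zeta> y" by blast
    show "z \<noteq> cnj w"
    proof
      assume "z = cnj w"
      then have "x = y" using \<zeta>[OF xy(1)] \<zeta>[OF xy(2)] complex_param_cnj complex_param_unique xy(3,4) by metis
      with \<open>z = cnj w\<close> xy have "z = cnj z" by simp
      then have "Im z = - Im z" by (metis cnj.simps(2))
      then show False using \<zeta>[OF xy(1)] xy(3) by simp
    qed
  qed (use finP \<tau>0 in \<open>auto simp: S_def E_def\<close>)
  moreover have "card (\<tau> ` P1) = card S + card E"
    using finP by (subst card_Un_disjoint[symmetric]) (auto simp: S_def E_def intro!: arg_cong[of _ _ card])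
  moreover have "card (\<tau> ` P1) = card P1" "card (\<zeta> ` P2) = card P2" using inj\<tau> inj\<zeta> by (auto intro: card_image)
  moreover have "card P = card P1 + card P2"
    using finP by (subst card_Un_disjoint[symmetric]) (auto simp: P1_def P2_def intro!: arg_cong[of _ _ card])
  moreover have "card E \<le> card {t\<in>B. ?\<gamma> t \<in> P}"
    using fin \<tau> by (intro card_mono) (auto simp: E_def P1_def)
  ultimately show ?thesis using dF by linarith
qed

lemma mono_fun_zero [simp]: "mono_fun (\<lambda>_. 0) x = 1"
  by (simp add: mono_fun_def)

lemma continuous_on_mono_fun: "continuous_on A (mono_fun \<alpha> :: real ^ 'n::finite \<Rightarrow> real)"
  unfolding mono_fun_def by (intro continuous_intros)

lemma linear_combination_in_poly_funs:
  "(\<lambda>x. \<Sum>\<alpha>\<in>multi_indices k. a \<alpha> * mono_fun \<alpha> x) \<in> poly_funs k"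
  by (auto simp: poly_funs_def)

text \<open>\<open>T\<close> is the interval \<open>[-R, R]\<close> without small arcs around the real zeros of \<open>\<psi>\<^sub>0\<close>, so that the curve
  over \<open>T\<close> is compact; \<open>B\<close> contains its at most \<open>2p + 2\<close> end points, where a nonnegative function may have
  a simple zero. Removing the mass at the end point \<open>R\<close> costs one node but excludes one simple zero.\<close>

lemma reduce_nodes:
  fixes \<psi> :: "'n::finite \<Rightarrow> real poly"
  assumes \<psi>0: "\<psi>0 \<noteq> 0" and deg: "degree \<psi>0 \<le> m" "\<And>i. degree (\<psi> i) \<le> m"
    and X: "finite X" "\<And>x. x \<in> X \<Longrightarrow> \<exists>z. complex_param \<psi>0 \<psi> z x"
    and y: "cone_mem (multi_indices (2 * s)) mono_fun X y"
  shows "\<exists>P w. finite P \<and> (\<forall>x\<in>P. 0 < w x) \<and>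
    (\<forall>\<alpha>\<in>multi_indices (2 * s). y \<alpha> = (\<Sum>x\<in>P. w x * mono_fun \<alpha> x)) \<and>
    card P \<le> m * s + card {t. poly \<psi>0 t = 0} + 1"
proof -
  let ?\<gamma> = "param_value \<psi>0 \<psi>"
  define U where "U = {t. poly \<psi>0 t = 0}"
  have U: "finite U" unfolding U_def by (rule poly_roots_finite[OF \<psi>0])
  obtain z where z: "\<And>x. x \<in> X \<Longrightarrow> complex_param \<psi>0 \<psi> (z x) x" using X(2) by metis
  \<comment> \<open>Points whose chosen parameter is nonreal join \<open>K\<close> as a separate
    finite set. They need no neighbourhood in \<open>T\<close>, as the conjugate parameter supplies
    the second zero.\<close>
  define Y where "Y = {x\<in>X. Im (z x) \<noteq> 0}"
  define A where "A = (\<lambda>x. Re (z x)) ` (X - Y)"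
  have zA: "z x = of_real (Re (z x))" if "x \<in> X - Y" for x
    using that by (simp add: Y_def complex_eq_iff)
  have A: "finite A" "A \<inter> U = {}"
  proof -
    show "finite A" using X(1) by (simp add: A_def)
    have "poly \<psi>0 (Re (z x)) \<noteq> 0" if "x \<in> X - Y" for x
      using z[of x] zA[OF that] that by (metis DiffD1 complex_param_of_real)
    then show "A \<inter> U = {}" by (auto simp: A_def U_def)
  qed
  \<comment> \<open>Arcs of radius \<open>\<delta>\<close> around the poles avoid the parameters
    \<open>A\<close> of the given nodes; the 1 covers the case that there are no poles or no such
    parameters.\<close>
  define \<delta> where "\<delta> = Min (insert 1 ((\<lambda>(a,u). \<bar>a - u\<bar>) ` (A \<times> U)))"
  have finAU: "finite (insert 1 ((\<lambda>(a,u). \<bar>a - u\<bar>) ` (A \<times> U)))" using A U by simp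
  have \<delta>: "\<delta> > 0" unfolding \<delta>_def using A finAU by (subst Min_gr_iff) auto
  have \<delta>le: "\<delta> \<le> \<bar>a - u\<bar>" if "a \<in> A" "u \<in> U" for a u
    unfolding \<delta>_def using finAU by (rule Min_le) (use that in force)
  \<comment> \<open>The margin \<open>\<delta>\<close> keeps \<open>R\<close> off the arcs around
    the poles, so that \<open>R\<close> lies in \<open>T\<close> and can serve as the parameter of
    \<open>e\<close>.\<close>
  define R where "R = Max (insert 0 (abs ` (A \<union> U))) + \<delta>"
  have Rle: "\<bar>t\<bar> + \<delta> \<le> R" if "t \<in> A \<union> U" for t
    unfolding R_def using A U that by (intro add_right_mono Max_ge) auto
  have Rpos: "R > 0"
  proof -
    have "0 \<le> Max (insert 0 (abs ` (A \<union> U)))" using A U by (intro Max_ge) auto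
    then show ?thesis using \<delta> by (simp add: R_def)
  qed
  define T where "T = {t. \<bar>t\<bar> \<le> R \<and> (\<forall>u\<in>U. \<delta> \<le> \<bar>t - u\<bar>)}"
  define B where "B = {R, - R} \<union> (\<lambda>u. u + \<delta>) ` U \<union> (\<lambda>u. u - \<delta>) ` U"
  have T: "compact T"
  proof -
    have "closed ({t. \<bar>t\<bar> \<le> R} \<inter> (\<Inter>u\<in>U. {t. \<delta> \<le> \<bar>t - u\<bar>}))"
      by (intro closed_Int closed_INT ballI closed_Collect_le continuous_intros)
    also have "{t. \<bar>t\<bar> \<le> R} \<inter> (\<Inter>u\<in>U. {t. \<delta> \<le> \<bar>t - u\<bar>}) = T" by (auto simp: T_def)
    finally have "closed T" .
    moreover have "T \<subseteq> {-R..R}" by (auto simp: T_def)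
    ultimately show ?thesis using compact_Int_closed[OF compact_Icc[of "-R" R]] by (metis Int_absorb1)
  qed
  have T0: "poly \<psi>0 t \<noteq> 0" if "t \<in> T" for t using that \<delta> by (fastforce simp: T_def U_def)
  have B: "finite B" "card B \<le> 2 * card U + 2"
  proof -
    show "finite B" using U by (simp add: B_def)
    have "card B \<le> card {R, - R} + card ((\<lambda>u. u + \<delta>) ` U) + card ((\<lambda>u. u - \<delta>) ` U)"
      unfolding B_def by (meson add_right_mono card_Un_le order_trans)
    also have "\<dots> \<le> 2 + card U + card U"
      by (intro add_mono card_image_le U) (simp add: card_insert_if)
    finally show "card B \<le> 2 * card U + 2" by simp
  qed
  have int: "\<exists>\<epsilon>>0. ball t \<epsilon> \<subseteq> T" if "t \<in> T - B" for t
  proof -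
    define V where "V = {t. \<bar>t\<bar> < R} \<inter> (\<Inter>u\<in>U. {t. \<delta> < \<bar>t - u\<bar>})"
    have "open V" unfolding V_def
      by (intro open_Int open_INT U ballI open_Collect_less continuous_intros)
    moreover have "t \<in> V"
    proof -
      have "\<bar>t\<bar> \<noteq> R" using that Rpos by (auto simp: B_def abs_if split: if_splits)
      moreover have "\<bar>t - u\<bar> \<noteq> \<delta>" if "u \<in> U" for u
      proof
        assume "\<bar>t - u\<bar> = \<delta>"
        then have "t = u + \<delta> \<or> t = u - \<delta>" by linarith
        then show False using \<open>t \<in> T - B\<close> \<open>u \<in> U\<close> by (auto simp: B_def)
      qed
      ultimately show ?thesis using that by (auto simp: V_def T_def order_less_le)
    qed
    moreover have "V \<subseteq> T" by (auto simp: V_def T_def intro: less_imp_le)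
    ultimately show ?thesis unfolding open_contains_ball by blast
  qed
  define K where "K = ?\<gamma> ` T \<union> Y"
  have "continuous_on T ?\<gamma>"
    unfolding param_value_def using T0 by (intro continuous_on_vec_lambda continuous_intros) auto
  moreover have "finite Y" unfolding Y_def using X(1) by simp
  ultimately have K: "compact K"
    unfolding K_def by (intro compact_Un compact_continuous_image T finite_imp_compact)
  have RT: "R \<in> T" using Rpos Rle \<delta> by (force simp: T_def)
  define e where "e = ?\<gamma> R"
  have e: "e \<in> K" using RT by (simp add: K_def e_def)
  have AT: "A \<subseteq> T" using Rle \<delta>le \<delta> by (force simp: T_def)
  have "X \<subseteq> K"
  proof
    fix x assume x: "x \<in> X"
    show "x \<in> K"
    proof (cases "x \<in> Y")
      case False
      then have xm: "x \<in> X - Y" using x by simp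
      then have "x = ?\<gamma> (Re (z x))" using z[OF x] zA by (metis complex_param_of_real)
      moreover have "Re (z x) \<in> T" using AT xm by (auto simp: A_def)
      ultimately show ?thesis unfolding K_def by blast
    qed (simp add: K_def)
  qed
  then have yK: "cone_mem (multi_indices (2 * s)) mono_fun K y"
    using y unfolding cone_mem_def by (meson order_trans)
  have zero_in: "(\<lambda>_. 0) \<in> multi_indices (2 * s)" by (simp add: multi_indices_def)
  obtain c P w a where c: "0 \<le> c" and P: "finite P" "P \<subseteq> K" and w: "\<And>x. x \<in> P \<Longrightarrow> 0 < w x"
    and eq: "\<And>\<alpha>. \<alpha> \<in> multi_indices (2 * s) \<Longrightarrow> y \<alpha> = c * mono_fun \<alpha> e + (\<Sum>x\<in>P. w x * mono_fun \<alpha> x)"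
    and a1: "\<And>x. x \<in> K \<Longrightarrow> 0 \<le> (\<Sum>\<alpha>\<in>multi_indices (2 * s). a \<alpha> * mono_fun \<alpha> x)"
    and a2: "\<exists>x\<in>K. 0 < (\<Sum>\<alpha>\<in>multi_indices (2 * s). a \<alpha> * mono_fun \<alpha> x)"
    and a3: "\<And>x. x \<in> P \<Longrightarrow> (\<Sum>\<alpha>\<in>multi_indices (2 * s). a \<alpha> * mono_fun \<alpha> x) = 0"
    by (rule extremal_representation[OF finite_multi_indices zero_in mono_fun_zero K continuous_on_mono_fun e yK])
       (rule that)
  define f where "f x = (\<Sum>\<alpha>\<in>multi_indices (2 * s). a \<alpha> * mono_fun \<alpha> x)" for x
  have count: "2 * card P \<le> 2 * s * m + card {t\<in>B. ?\<gamma> t \<in> P}"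
  proof (rule card_zeros_nonneg_poly_fun[where f = f and T = T and Y = Y])
    show "f \<in> poly_funs (2 * s)" unfolding f_def by (rule linear_combination_in_poly_funs)
    show "\<exists>z. Im z \<noteq> 0 \<and> complex_param \<psi>0 \<psi> z x" if "x \<in> Y" for x
      using that z by (auto simp: Y_def)
    show "0 \<le> f (?\<gamma> t)" if "t \<in> T" for t using a1 that by (auto simp: f_def K_def)
    show "\<exists>x\<in>?\<gamma> ` T \<union> Y. f x \<noteq> 0" using a2 unfolding f_def K_def by force
    show "P \<subseteq> ?\<gamma> ` T \<union> Y" using P(2) by (simp add: K_def)
    show "f x = 0" if "x \<in> P" for x using a3[OF that] by (simp add: f_def)
  qed (use deg T0 B int P(1) in auto)
  \<comment> \<open>If \<open>e\<close> is in \<open>P\<close>, its extra mass costs no node.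
    Otherwise \<open>R\<close> is missing from the simple zeros, at most
    \<open>2 * card U + 1\<close> are left, and by parity \<open>P\<close> has at most
    \<open>m * s + card U\<close> points, leaving room for \<open>e\<close>.\<close>
  have count2: "card P + (if e \<in> P then 0 else 1) \<le> m * s + card U + 1"
  proof (cases "e \<in> P")
    case True
    have "card {t\<in>B. ?\<gamma> t \<in> P} \<le> card B" by (intro card_mono B) auto
    then show ?thesis using True count B(2) by (simp add: mult.commute)
  next
    case False
    have "card {t\<in>B. ?\<gamma> t \<in> P} \<le> card (B - {R})" using False B(1) by (intro card_mono) (auto simp: e_def)
    also have "\<dots> = card B - 1" by (rule card_Diff_singleton) (simp add: B_def)
    finally have "card {t\<in>B. ?\<gamma> t \<in> P} \<le> 2 * card U + 1" using B(2) by simp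
    then have "2 * card P \<le> 2 * (m * s) + 2 * card U + 1" using count by (simp add: mult_ac)
    then have "card P \<le> m * s + card U" by presburger
    then show ?thesis using False by simp
  qed
  show ?thesis
  proof (cases "c = 0")
    case True
    then show ?thesis using P(1) w eq count2 unfolding U_def
      by (intro exI[of _ P] exI[of _ w]) auto
  next
    case False
    define w' where "w' x = (if x \<in> P then w x else 0) + (if x = e then c else 0)" for x
    have "(\<Sum>x\<in>insert e P. w' x * mono_fun \<alpha> x) = c * mono_fun \<alpha> e + (\<Sum>x\<in>P. w x * mono_fun \<alpha> x)" for \<alpha>
      unfolding w'_def by (rule sum_insert_point_mass[OF P(1)])
    moreover have "0 < w' x" if "x \<in> insert e P" for x
      using that w c False by (auto simp: w'_def add_pos_nonneg add_nonneg_pos)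
    moreover have "card (insert e P) \<le> m * s + card U + 1"
      using count2 P(1) by (auto simp: card_insert_if split: if_splits)
    ultimately show ?thesis using P(1) eq unfolding U_def
      by (intro exI[of _ "insert e P"] exI[of _ w']) auto
  qed
qed

section \<open>Reduction to discrete measures\<close>

text \<open>By the Lindelof property the union of all open null sets is already the union of
  countably many of them.\<close>

lemma emeasure_compl_measure_support:
  fixes \<mu> :: "'a::second_countable_topology measure"
  assumes sets: "sets \<mu> = sets borel"
  shows "emeasure \<mu> (- measure_support \<mu>) = 0"
proof -
  define \<U> where "\<U> = {U. open U \<and> emeasure \<mu> U = 0}"
  have "- measure_support \<mu> = \<Union>\<U>"
    unfolding measure_support_def \<U>_def
    by (auto simp: open_closed) (metis closed_Compl compl_le_compl_iff double_complement open_closed order_refl ComplD ComplI)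
  moreover obtain \<V> where \<V>: "\<V> \<subseteq> \<U>" "countable \<V>" "\<Union>\<V> = \<Union>\<U>"
    by (rule Lindelof[of \<U>]) (auto simp: \<U>_def)
  moreover have "(\<Union>V\<in>\<V>. V) \<in> null_sets \<mu>"
    using \<V> by (intro null_sets_UN') (auto simp: \<U>_def null_sets_def sets)
  ultimately show ?thesis by (simp add: null_sets_def)
qed

lemma closed_zariski_closure: "closed (zariski_closure S :: (real ^ 'n::finite) set)"
proof -
  have cont: "continuous_on UNIV f" if "f \<in> poly_funs k" for f :: "real ^ 'n \<Rightarrow> real" and k
  proof -
    obtain c where "f = (\<lambda>x. \<Sum>\<alpha>\<in>multi_indices k. c \<alpha> * mono_fun \<alpha> x)"
      using \<open>f \<in> poly_funs k\<close> unfolding poly_funs_def by blast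
    then show ?thesis by (simp add: continuous_on_sum continuous_on_mult_left continuous_on_mono_fun)
  qed
  define \<F> where "\<F> = {f :: real ^ 'n \<Rightarrow> real. (\<exists>k. f \<in> poly_funs k) \<and> (\<forall>y\<in>S. f y = 0)}"
  have "closed (\<Inter>f\<in>\<F>. {x. f x = 0})"
    by (intro closed_INT ballI closed_Collect_eq continuous_on_const) (auto simp: \<F>_def intro: cont)
  moreover have "(\<Inter>f\<in>\<F>. {x. f x = 0}) = zariski_closure S"
    by (auto simp: \<F>_def zariski_closure_def)
  ultimately show ?thesis by simp
qed

text \<open>Outside the cone there would be a function that is nonnegative and not identically zero
  on \<open>C\<close> with integral at most 0. It vanishes almost everywhere, and by
  \<open>fin\<close>, where the curve enters, it has finitely many zeros on \<open>C\<close>. So the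
  measure is a finite sum of point masses, and its moments lie in the cone after all.\<close>

lemma cone_mem_moments:
  fixes \<mu> :: "(real ^ 'n::finite) measure"
  assumes sets: "sets \<mu> = sets borel" and C: "closed C" "C \<noteq> {}" and null: "emeasure \<mu> (- C) = 0"
    and mom: "finite_moments \<mu> k"
    and fin: "\<And>f. f \<in> poly_funs k \<Longrightarrow> \<exists>x\<in>C. f x \<noteq> 0 \<Longrightarrow> finite {x\<in>C. f x = 0}"
  shows "cone_mem (multi_indices k) mono_fun C (\<lambda>\<alpha>. LINT x|\<mu>. mono_fun \<alpha> x)"
proof (rule ccontr)
  assume neg: "\<not> ?thesis"
  let ?I = "multi_indices k :: ('n \<Rightarrow> nat) set"
  define y where "y \<alpha> = (LINT x|\<mu>. mono_fun \<alpha> x)" for \<alpha> :: "'n \<Rightarrow> nat"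
  obtain e where e: "e \<in> C" using C(2) by blast
  have int: "integrable \<mu> (mono_fun \<alpha>)" if "\<alpha> \<in> ?I" for \<alpha>
    using mom that by (simp add: finite_moments_def)
  have AEC: "AE x in \<mu>. x \<in> C"
  proof (rule AE_I)
    show "{x \<in> space \<mu>. x \<notin> C} \<subseteq> - C" by auto
    show "- C \<in> sets \<mu>" using C(1) by (simp add: sets open_Compl borel_open)
  qed (rule null)
  have lin: "integrable \<mu> (\<lambda>x. \<Sum>\<alpha>\<in>?I. a \<alpha> * mono_fun \<alpha> x)"
    "(LINT x|\<mu>. (\<Sum>\<alpha>\<in>?I. a \<alpha> * mono_fun \<alpha> x)) = (\<Sum>\<alpha>\<in>?I. a \<alpha> * y \<alpha>)" for a
    using int by (simp_all add: y_def)
  have "\<exists>a. (\<forall>x\<in>C. 0 \<le> (\<Sum>\<alpha>\<in>?I. a \<alpha> * mono_fun \<alpha> x)) \<and> (\<exists>x\<in>C. 0 < (\<Sum>\<alpha>\<in>?I. a \<alpha> * mono_fun \<alpha> x))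
      \<and> (\<Sum>\<alpha>\<in>?I. a \<alpha> * y \<alpha>) \<le> 0"
  proof (rule supporting_functional[OF finite_multi_indices e])
    fix a assume a: "\<And>x. x \<in> C \<Longrightarrow> (\<Sum>\<alpha>\<in>?I. a \<alpha> * mono_fun \<alpha> x) = 0"
    have "(LINT x|\<mu>. (\<Sum>\<alpha>\<in>?I. a \<alpha> * mono_fun \<alpha> x)) = 0"
      by (rule integral_eq_zero_AE) (use AEC in eventually_elim, rule a)
    then show "(\<Sum>\<alpha>\<in>?I. a \<alpha> * y \<alpha>) = 0" by (simp add: lin)
  next
    fix \<epsilon> :: real assume \<epsilon>: "\<epsilon> > 0"
    show "\<not> cone_mem ?I mono_fun C (\<lambda>\<alpha>. y \<alpha> - \<epsilon> * mono_fun \<alpha> e)"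
    proof
      assume "cone_mem ?I mono_fun C (\<lambda>\<alpha>. y \<alpha> - \<epsilon> * mono_fun \<alpha> e)"
      then obtain P w where P: "finite P" "P \<subseteq> C" "\<forall>x\<in>P. 0 \<le> w x"
        "\<forall>\<alpha>\<in>?I. y \<alpha> - \<epsilon> * mono_fun \<alpha> e = (\<Sum>x\<in>P. w x * mono_fun \<alpha> x)"
        unfolding cone_mem_def by blast
      define w' where "w' x = (if x \<in> P then w x else 0) + (if x = e then \<epsilon> else 0)" for x
      have "(\<Sum>x\<in>insert e P. w' x * mono_fun \<alpha> x) = \<epsilon> * mono_fun \<alpha> e + (\<Sum>x\<in>P. w x * mono_fun \<alpha> x)" for \<alpha>
        unfolding w'_def by (rule sum_insert_point_mass[OF P(1)])
      moreover have "y \<alpha> = \<epsilon> * mono_fun \<alpha> e + (\<Sum>x\<in>P. w x * mono_fun \<alpha> x)" if "\<alpha> \<in> ?I" for \<alpha>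
        using P(4) that by (metis add.commute diff_add_cancel)
      ultimately have "\<forall>\<alpha>\<in>?I. y \<alpha> = (\<Sum>x\<in>insert e P. w' x * mono_fun \<alpha> x)" by simp
      moreover have "\<forall>x\<in>insert e P. 0 \<le> w' x" using P(3) \<epsilon> by (auto simp: w'_def)
      moreover have "finite (insert e P)" "insert e P \<subseteq> C" using P e by auto
      ultimately have "cone_mem ?I mono_fun C y" unfolding cone_mem_def by blast
      then show False using neg by (simp add: y_def[abs_def])
    qed
  qed
  then obtain a where a: "\<And>x. x \<in> C \<Longrightarrow> 0 \<le> (\<Sum>\<alpha>\<in>?I. a \<alpha> * mono_fun \<alpha> x)"
    "\<exists>x\<in>C. 0 < (\<Sum>\<alpha>\<in>?I. a \<alpha> * mono_fun \<alpha> x)" "(\<Sum>\<alpha>\<in>?I. a \<alpha> * y \<alpha>) \<le> 0" by (elim exE conjE) (rule that, simp_all)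
  define f where "f x = (\<Sum>\<alpha>\<in>?I. a \<alpha> * mono_fun \<alpha> x)" for x
  have f: "f \<in> poly_funs k" unfolding f_def by (rule linear_combination_in_poly_funs)
  have nn: "AE x in \<mu>. 0 \<le> f x" using AEC by eventually_elim (simp add: a f_def)
  have fint: "integrable \<mu> f" unfolding f_def by (rule lin)
  have "(LINT x|\<mu>. f x) = 0"
    using integral_nonneg_AE[OF nn] a(3) unfolding f_def lin by linarith
  then have AE0: "AE x in \<mu>. f x = 0" using integral_nonneg_eq_0_iff_AE[OF fint nn] by simp
  define N where "N = {x\<in>C. f x = 0}"
  have N: "finite N" unfolding N_def by (rule fin[OF f]) (use a(2) in \<open>force simp: f_def\<close>)
  have AEN: "AE x in \<mu>. x \<in> N" using AEC AE0 by eventually_elim (simp add: N_def)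
  have "integrable \<mu> (\<lambda>x. 1 :: real)"
    using int[of "\<lambda>_. 0"] by (simp add: multi_indices_def mono_fun_zero[abs_def])
  then have fm: "finite_measure \<mu>"
    by (intro finite_measureI) (simp add: integrable_iff_bounded top.not_eq_extremum)
  then interpret finite_measure \<mu> .
  have "y \<alpha> = (\<Sum>x\<in>N. measure \<mu> {x} * mono_fun \<alpha> x)" for \<alpha>
  proof -
    have sing: "{x} \<in> sets \<mu>" for x by (simp add: sets)
    have meas: "mono_fun \<alpha> \<in> borel_measurable \<mu>"
      unfolding measurable_cong_sets[OF sets refl]
      by (intro borel_measurable_continuous_onI continuous_on_mono_fun)
    have "y \<alpha> = (LINT u|\<mu>. (\<Sum>x\<in>N. indicator {x} u * mono_fun \<alpha> x))"
      unfolding y_def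
    proof (rule integral_cong_AE[OF meas])
      show "AE u in \<mu>. mono_fun \<alpha> u = (\<Sum>x\<in>N. indicator {x} u * mono_fun \<alpha> x)"
        using AEN
      proof eventually_elim
        case (elim u)
        have "(\<Sum>x\<in>N. indicator {x} u * mono_fun \<alpha> x) = (\<Sum>x\<in>N. if x = u then mono_fun \<alpha> x else 0)"
          by (intro sum.cong) (auto simp: indicator_def)
        then show ?case using elim N by simp
      qed
    qed (use sing in measurable)
    also have "\<dots> = (\<Sum>x\<in>N. measure \<mu> {x} * mono_fun \<alpha> x)"
      using sing by (subst Bochner_Integration.integral_sum) (auto simp: sets_eq_imp_space_eq[OF sets] less_top[symmetric])
    finally show ?thesis .
  qed
  then have "cone_mem ?I mono_fun C y"
    unfolding cone_mem_def using N by (intro exI[of _ N] exI[of _ "\<lambda>x. measure \<mu> {x}"]) (auto simp: N_def)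
  then show False using neg by (simp add: y_def[abs_def])
qed

section \<open>Change of parameter\<close>

text \<open>This is \<open>u\<^bsup>m\<^esup> p(t\<^sub>0 + 1/u)\<close> as a polynomial in \<open>u\<close>; the point at infinity moves to \<open>u = 0\<close>.\<close>

definition moebius_poly :: "nat \<Rightarrow> real \<Rightarrow> real poly \<Rightarrow> real poly" where
  "moebius_poly m t0 p = (\<Sum>j\<le>m. smult (coeff p j) ([:1, t0:] ^ j * monom 1 (m - j)))"

lemma degree_moebius_poly: "degree (moebius_poly m t0 p) \<le> m"
  unfolding moebius_poly_def
proof (intro degree_sum_le finite_atMost)
  fix j assume j: "j \<in> {..m}"
  have "degree ([:1, t0:] ^ j * monom 1 (m - j)) \<le> degree ([:1, t0:] ^ j) + degree (monom (1::real) (m - j))"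
    by (rule degree_mult_le)
  also have "\<dots> \<le> 1 * j + (m - j)"
    by (intro add_mono order_trans[OF degree_power_le] mult_right_mono degree_monom_le) auto
  finally show "degree (smult (coeff p j) ([:1, t0:] ^ j * monom 1 (m - j))) \<le> m"
    using j order_trans[OF degree_smult_le] by fastforce
qed

lemma poly_moebius_poly:
  assumes "degree p \<le> m" "u \<noteq> 0"
  shows "poly (cpoly (moebius_poly m t0 p)) u = u ^ m * poly (cpoly p) (of_real t0 + 1 / u)"
proof -
  have q: "of_real t0 + 1 / u = (1 + u * of_real t0) / u" using assms(2) by (simp add: field_simps)
  have "poly (cpoly (moebius_poly m t0 p)) u
      = (\<Sum>j\<le>m. of_real (coeff p j) * ((1 + u * of_real t0) ^ j * u ^ (m - j)))"
    by (simp add: moebius_poly_def cpoly_sum poly_sum map_poly_pCons map_poly_monom poly_monom)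
  also have "\<dots> = (\<Sum>j\<le>m. u ^ m * (of_real (coeff p j) * (of_real t0 + 1 / u) ^ j))"
    using assms(2) by (intro sum.cong refl) (simp add: q power_divide power_diff)
  also have "\<dots> = u ^ m * (\<Sum>j<Suc m. coeff (cpoly p) j * (of_real t0 + 1 / u) ^ j)"
    by (simp add: sum_distrib_left lessThan_Suc_atMost coeff_map_poly)
  also have "\<dots> = u ^ m * poly (cpoly p) (of_real t0 + 1 / u)"
    by (subst poly_eq_sum_lessThan[where N = "Suc m"]) (use assms in auto)
  finally show ?thesis .
qed

lemma poly_moebius_poly_0: "poly (cpoly (moebius_poly m t0 p)) 0 = of_real (coeff p m)"
proof -
  have "poly (cpoly (moebius_poly m t0 p)) 0 = (\<Sum>j\<le>m. of_real (coeff p j) * 0 ^ (m - j))"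
    by (simp add: moebius_poly_def cpoly_sum poly_sum map_poly_pCons map_poly_monom poly_monom)
  also have "\<dots> = (\<Sum>j\<le>m. if j = m then of_real (coeff p j) else 0)"
    by (intro sum.cong refl) (auto simp: power_0_left)
  finally show ?thesis by simp
qed

text \<open>With \<open>t0\<close> off the real parts of the chosen parameters, each of these
  becomes the finite value \<open>1 / (z - t0)\<close>, and infinity becomes 0. By
  \<open>lead\<close> the new denominator does not vanish at 0, so every new real pole comes from an
  old one and their number cannot grow.\<close>

lemma moebius_reparametrization:
  fixes \<phi> :: "'n::finite \<Rightarrow> real poly"
  assumes deg: "degree \<phi>0 \<le> m" "\<And>i. degree (\<phi> i) \<le> m" and lead: "coeff \<phi>0 m \<noteq> 0"
    and X: "finite X" "\<And>x. x \<in> X \<Longrightarrow> (\<exists>z. complex_param \<phi>0 \<phi> z x) \<or> (\<forall>i. coeff (\<phi> i) m = x $ i * coeff \<phi>0 m)"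
  obtains \<psi>0 and \<psi> :: "'n \<Rightarrow> real poly" where "\<psi>0 \<noteq> 0" "degree \<psi>0 \<le> m" "\<And>i. degree (\<psi> i) \<le> m"
    "\<And>x. x \<in> X \<Longrightarrow> \<exists>z. complex_param \<psi>0 \<psi> z x"
    "card {t. poly \<psi>0 t = 0} \<le> card {t. poly \<phi>0 t = 0}"
proof -
  have "\<exists>z. x \<in> X \<longrightarrow> (complex_param \<phi>0 \<phi> z x \<or> (\<forall>i. coeff (\<phi> i) m = x $ i * coeff \<phi>0 m))" for x
    using X(2) by blast
  then obtain z where z: "\<And>x. x \<in> X \<Longrightarrow> complex_param \<phi>0 \<phi> (z x) x \<or> (\<forall>i. coeff (\<phi> i) m = x $ i * coeff \<phi>0 m)"
    by metis
  obtain t0 where t0: "t0 \<notin> (\<lambda>x. Re (z x)) ` X"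
    using ex_new_if_finite[OF infinite_UNIV_char_0] X(1) by blast
  define M where "M = moebius_poly m t0"
  have lead0: "poly (cpoly (M \<phi>0)) 0 \<noteq> 0" using lead by (simp add: M_def poly_moebius_poly_0)
  have \<phi>0: "\<phi>0 \<noteq> 0" using lead by auto
  have params: "\<exists>u. complex_param (M \<phi>0) (\<lambda>i. M (\<phi> i)) u x" if x: "x \<in> X" for x
  proof (cases "complex_param \<phi>0 \<phi> (z x) x")
    case True
    have "z x \<noteq> of_real t0" using t0 x by force
    define u where "u = 1 / (z x - of_real t0)"
    have u: "u \<noteq> 0" "of_real t0 + 1 / u = z x" using \<open>z x \<noteq> of_real t0\<close> by (auto simp: u_def)
    have "complex_param (M \<phi>0) (\<lambda>i. M (\<phi> i)) u x"
      using True u deg by (simp add: complex_param_def M_def poly_moebius_poly)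
    then show ?thesis ..
  next
    case False
    then have "\<forall>i. coeff (\<phi> i) m = x $ i * coeff \<phi>0 m" using z x by blast
    then have "complex_param (M \<phi>0) (\<lambda>i. M (\<phi> i)) 0 x"
      using lead by (simp add: complex_param_def M_def poly_moebius_poly_0)
    then show ?thesis ..
  qed
  have r0: "u \<noteq> 0 \<and> poly \<phi>0 (t0 + 1 / u) = 0" if "poly (M \<phi>0) u = 0" for u
  proof -
    have pu: "poly (cpoly (M \<phi>0)) (of_real u) = 0" using that by simp
    then have "u \<noteq> 0" using lead0 by (metis of_real_0)
    moreover from this pu have "poly (cpoly \<phi>0) (of_real (t0 + 1 / u)) = 0"
      using deg(1) unfolding M_def by (subst (asm) poly_moebius_poly) auto
    ultimately show ?thesis unfolding poly_cpoly_of_real of_real_eq_0_iff by blast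
  qed
  have "card {u. poly (M \<phi>0) u = 0} \<le> card {t. poly \<phi>0 t = 0}"
  proof (rule card_inj_on_le)
    show "inj_on (\<lambda>u. t0 + 1 / u) {u. poly (M \<phi>0) u = 0}"
      using r0 by (auto simp: inj_on_def)
  qed (use r0 poly_roots_finite[OF \<phi>0] in auto)
  moreover have "M \<phi>0 \<noteq> 0" using lead0 by auto
  ultimately show thesis using params by (intro that[of "M \<phi>0" "\<lambda>i. M (\<phi> i)"]) (auto simp: M_def degree_moebius_poly)
qed

text \<open>At a common zero of \<open>\<phi>0\<close> and all \<open>\<phi> i\<close> the forms
  \<open>\<phi> i - x $ i * \<phi>0\<close> would vanish for every \<open>x\<close>, which blocks
  the Bezout argument for points of the closure. Dividing by the common divisor raises neither the
  degrees nor the number of poles and can only enlarge the image.\<close>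

lemma coprime_parametrization:
  fixes \<phi> :: "'n::finite \<Rightarrow> real poly"
  assumes \<phi>0: "\<phi>0 \<noteq> 0"
  obtains \<psi>0 and \<psi> :: "'n \<Rightarrow> real poly" where "\<psi>0 \<noteq> 0"
    "degree \<psi>0 \<le> degree \<phi>0" "\<And>i. degree (\<psi> i) \<le> degree (\<phi> i)"
    "card {t. poly \<psi>0 t = 0} \<le> card {t. poly \<phi>0 t = 0}"
    "param_image \<phi>0 \<phi> \<subseteq> param_image \<psi>0 \<psi>"
    "\<And>z. poly (cpoly \<psi>0) z = 0 \<Longrightarrow> \<exists>i. poly (cpoly (\<psi> i)) z \<noteq> 0"
proof -
  define \<Phi> where "\<Phi> = case_option \<phi>0 \<phi>"
  obtain g A where g: "g = (\<Sum>i\<in>UNIV. A i * \<Phi> i)" and dvd: "\<And>i. g dvd \<Phi> i"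
    using poly_ideal_principal[of \<Phi>] by blast
  have "g \<noteq> 0" using dvd[of None] \<phi>0 by (auto simp: \<Phi>_def)
  define \<Psi> where "\<Psi> i = \<Phi> i div g" for i
  have \<Psi>: "\<Phi> i = g * \<Psi> i" for i using dvd[of i] by (simp add: \<Psi>_def)
  have "g * (\<Sum>i\<in>UNIV. A i * \<Psi> i) = (\<Sum>i\<in>UNIV. A i * \<Phi> i)"
    unfolding sum_distrib_left \<Psi> by (intro sum.cong refl) (simp only: mult.left_commute)
  then have "g * (\<Sum>i\<in>UNIV. A i * \<Psi> i) = g * 1" using g by simp
  then have bez: "(\<Sum>i\<in>UNIV. A i * \<Psi> i) = 1" by (rule mult_left_cancel[OF \<open>g \<noteq> 0\<close>, THEN iffD1])
  have N: "\<phi>0 = g * \<Psi> None" and S: "\<phi> i = g * \<Psi> (Some i)" for i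
    using \<Psi>[of None] \<Psi>[of "Some i"] by (simp_all add: \<Phi>_def)
  have degle: "degree q \<le> degree (g * q)" for q
    using \<open>g \<noteq> 0\<close> by (cases "q = 0") (auto simp: degree_mult_eq)
  show thesis
  proof (rule that[of "\<Psi> None" "\<lambda>i. \<Psi> (Some i)"])
    show "\<Psi> None \<noteq> 0" using N \<phi>0 by auto
    show "degree (\<Psi> None) \<le> degree \<phi>0" "degree (\<Psi> (Some i)) \<le> degree (\<phi> i)" for i
      using degle N S by auto
    show "card {t. poly (\<Psi> None) t = 0} \<le> card {t. poly \<phi>0 t = 0}"
      using poly_roots_finite[OF \<phi>0] by (intro card_mono) (auto simp: N)
    show "param_image \<phi>0 \<phi> \<subseteq> param_image (\<Psi> None) (\<lambda>i. \<Psi> (Some i))"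
    proof
      fix x assume "x \<in> param_image \<phi>0 \<phi>"
      then obtain t where t: "poly \<phi>0 t \<noteq> 0" "x = (\<chi> i. poly (\<phi> i) t / poly \<phi>0 t)"
        unfolding param_image_def by blast
      then have "poly (\<Psi> None) t \<noteq> 0" "x = (\<chi> i. poly (\<Psi> (Some i)) t / poly (\<Psi> None) t)"
        by (auto simp: N S vec_eq_iff)
      then show "x \<in> param_image (\<Psi> None) (\<lambda>i. \<Psi> (Some i))" unfolding param_image_def by blast
    qed
    show "\<exists>i. poly (cpoly (\<Psi> (Some i))) z \<noteq> 0" if z: "poly (cpoly (\<Psi> None)) z = 0" for z
    proof (rule ccontr)
      assume "\<not> ?thesis"
      then have "poly (cpoly (\<Psi> i)) z = 0" for i using z by (cases i) auto
      then have "poly (cpoly (\<Sum>i\<in>UNIV. A i * \<Psi> i)) z = 0" by (simp add: cpoly_sum poly_sum)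
      then show False by (simp add: bez)
    qed
  qed
qed

text \<open>The pullback is nonzero and so has finitely many zeros, each the parameter of at most
  one point. By \<open>lead\<close> at most one further point satisfies the condition at
  infinity.\<close>

lemma finite_zeros_on_curve:
  fixes \<phi> :: "'n::finite \<Rightarrow> real poly"
  assumes deg: "degree \<phi>0 \<le> m" "\<And>i. degree (\<phi> i) \<le> m"
    and lead: "coeff \<phi>0 m \<noteq> 0 \<or> (\<exists>i. coeff (\<phi> i) m \<noteq> 0)"
    and C: "\<And>x. x \<in> C \<Longrightarrow> (\<exists>z. complex_param \<phi>0 \<phi> z x) \<or> (\<forall>i. coeff (\<phi> i) m = x $ i * coeff \<phi>0 m)"
    and f: "f \<in> poly_funs k" and nz: "f x0 \<noteq> 0" "complex_param \<phi>0 \<phi> z0 x0"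
  shows "finite {x\<in>C. f x = 0}"
proof -
  obtain F where F: "\<And>z x. complex_param \<phi>0 \<phi> z x \<Longrightarrow> poly (cpoly F) z = of_real (f x) * poly (cpoly \<phi>0) z ^ k"
    by (rule poly_funs_pullback[where \<phi> = \<phi>, OF f deg]) (rule that)
  have "poly (cpoly F) z0 \<noteq> 0" using F[OF nz(2)] nz by (simp add: complex_param_def)
  then have "finite {z. poly (cpoly F) z = 0}" by (intro poly_roots_finite) auto
  moreover have "finite {x. complex_param \<phi>0 \<phi> z x}" for z
  proof (cases "\<exists>x. complex_param \<phi>0 \<phi> z x")
    case True
    then obtain x where x: "complex_param \<phi>0 \<phi> z x" ..
    have "{x. complex_param \<phi>0 \<phi> z x} \<subseteq> {x}" using complex_param_unique[OF x] by auto
    then show ?thesis by (rule finite_subset) simp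
  qed simp
  ultimately have "finite (\<Union>z\<in>{z. poly (cpoly F) z = 0}. {x. complex_param \<phi>0 \<phi> z x})" by blast
  moreover have "finite {x. \<forall>i. coeff (\<phi> i) m = x $ i * coeff \<phi>0 m}"
  proof (rule finite_subset[of _ "{\<chi> i. coeff (\<phi> i) m / coeff \<phi>0 m}"])
    show "{x. \<forall>i. coeff (\<phi> i) m = x $ i * coeff \<phi>0 m} \<subseteq> {\<chi> i. coeff (\<phi> i) m / coeff \<phi>0 m}"
      using lead by (auto simp: vec_eq_iff)
  qed simp
  ultimately show ?thesis
    by (rule finite_subset[rotated, OF finite_UnI]) (use C F in fastforce)
qed

text \<open>The degree of \<open>\<phi>0\<close> has to enter the bound:
  \<open>t \<mapsto> (1/(1+t^2), t/(1+t^2))\<close> parametrizes a circle with \<open>D = 1\<close>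
  and \<open>p = 0\<close>. Functions of degree at most \<open>s\<close> form a space of dimension
  \<open>2 * s + 1\<close> on it, so arc length needs at least \<open>2 * s + 1\<close> nodes,
  exactly the bound with \<open>max (degree \<phi>0) D = 2\<close>.\<close>

theorem theorem4p11:
  fixes C :: "(real ^ 'n::finite) set"
    and \<phi>0 :: "real poly" and \<phi> :: "'n \<Rightarrow> real poly"
    and d D p s :: nat
    and \<mu> :: "(real ^ 'n) measure"
  assumes "rational_curve_param C \<phi>0 \<phi>"
    and "curve_degree C d"
    and "degree \<phi>0 \<le> d" and "\<And>i. degree (\<phi> i) \<le> d"
    and "D = Max (range (\<lambda>i. degree (\<phi> i)))"
    and "p = card {t. poly \<phi>0 t = 0}"
    and "sets \<mu> = sets borel"
    and "measure_support \<mu> \<subseteq> C"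
    and "finite_moments \<mu> (2 * s)"
  shows "\<exists>P w. quadrature_rule \<mu> (2 * s) P w \<and> card P \<le> max (degree \<phi>0) D * s + p + 1"
proof -
  have C: "C = zariski_closure (param_image \<phi>0 \<phi>)" and \<phi>0: "\<phi>0 \<noteq> 0"
    using assms(1) by (auto simp: rational_curve_param_def)
  obtain \<psi>0 and \<psi> :: "'n \<Rightarrow> real poly" where \<psi>0: "\<psi>0 \<noteq> 0"
    and deg: "degree \<psi>0 \<le> degree \<phi>0" "\<And>i. degree (\<psi> i) \<le> degree (\<phi> i)"
    and card: "card {t. poly \<psi>0 t = 0} \<le> card {t. poly \<phi>0 t = 0}"
    and image: "param_image \<phi>0 \<phi> \<subseteq> param_image \<psi>0 \<psi>"
    and coprime: "\<And>z. poly (cpoly \<psi>0) z = 0 \<Longrightarrow> \<exists>i. poly (cpoly (\<psi> i)) z \<noteq> 0"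
    by (rule coprime_parametrization[where \<phi> = \<phi>, OF \<phi>0]) (rule that)
  define m where "m = Max (insert (degree \<psi>0) (range (\<lambda>i. degree (\<psi> i))))"
  have m: "degree \<psi>0 \<le> m" "\<And>i. degree (\<psi> i) \<le> m" unfolding m_def by (auto intro!: Max_ge simp del: Max_insert)
  have mle: "m \<le> max (degree \<phi>0) D"
  proof -
    have "degree (\<psi> i) \<le> D" for i
      using deg(2)[of i] unfolding assms(5) by (rule order_trans) simp
    then show ?thesis using deg(1) by (auto simp: m_def intro: max.coboundedI1 max.coboundedI2)
  qed
  \<comment> \<open>The coefficients of degree \<open>m\<close> are homogeneous coordinates of the
    point at t = \<infinity>, so they must not all vanish.\<close>
  have lead: "coeff \<psi>0 m \<noteq> 0 \<or> (\<exists>i. coeff (\<psi> i) m \<noteq> 0)"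
  proof -
    have "m \<in> insert (degree \<psi>0) (range (\<lambda>i. degree (\<psi> i)))" unfolding m_def by (rule Max_in) auto
    then consider "m = degree \<psi>0" | i where "m = degree (\<psi> i)" by auto
    then show ?thesis
    proof cases
      case 1
      then show ?thesis using \<psi>0 by simp
    next
      case (2 i)
      show ?thesis
      proof (cases "\<psi> i = 0")
        case True
        then have "m = degree \<psi>0" using 2 m(1) by simp
        then show ?thesis using \<psi>0 by simp
      next
        case False
        then show ?thesis using 2 by (metis leading_coeff_0_iff)
      qed
    qed
  qed
  have param: "(\<exists>z. complex_param \<psi>0 \<psi> z x) \<or> (\<forall>i. coeff (\<psi> i) m = x $ i * coeff \<psi>0 m)" if "x \<in> C" for x
  proof -
    have "x \<in> zariski_closure (param_image \<psi>0 \<psi>)"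
      using that image unfolding C zariski_closure_def by blast
    then show ?thesis
      by (rule zariski_closure_param_image_points[OF coprime m, rotated 1])
  qed
  have "cone_mem (multi_indices (2 * s)) mono_fun C (\<lambda>\<alpha>. LINT x|\<mu>. mono_fun \<alpha> x)"
  proof (rule cone_mem_moments[OF assms(7) _ _ _ assms(9)])
    show closed: "closed C" unfolding C by (rule closed_zariski_closure)
    have sub: "param_image \<phi>0 \<phi> \<subseteq> C" unfolding C zariski_closure_def by blast
    obtain t where "poly \<phi>0 t \<noteq> 0" using \<phi>0 poly_all_0_iff_0 by blast
    then show "C \<noteq> {}" using sub unfolding param_image_def by blast
    have "closed (measure_support \<mu>)" unfolding measure_support_def by (intro closed_Inter) auto
    then have "emeasure \<mu> (- C) \<le> emeasure \<mu> (- measure_support \<mu>)"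
      using assms(8) by (intro emeasure_mono) (auto simp: assms(7) open_Compl borel_open)
    then show "emeasure \<mu> (- C) = 0" by (simp add: emeasure_compl_measure_support[OF assms(7)])
    fix f :: "real ^ 'n \<Rightarrow> real" assume f: "f \<in> poly_funs (2 * s)" "\<exists>x\<in>C. f x \<noteq> 0"
    \<comment> \<open>The image is dense, so \<open>f\<close> is nonzero at a point with a real
      parameter, which makes its pullback nonzero.\<close>
    obtain y where y: "y \<in> param_image \<phi>0 \<phi>" "f y \<noteq> 0"
      using f unfolding C zariski_closure_def by blast
    then obtain t where "poly \<psi>0 t \<noteq> 0" "y = param_value \<psi>0 \<psi> t"
      using image unfolding param_image_def param_value_def by blast
    then have "complex_param \<psi>0 \<psi> (of_real t) y" by (simp add: complex_param_of_real)
    from finite_zeros_on_curve[OF m lead param f(1) y(2) this]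
    show "finite {x\<in>C. f x = 0}" .
  qed
  then obtain X v where X: "finite X" "X \<subseteq> C" "\<forall>x\<in>X. 0 \<le> v x"
    "\<forall>\<alpha>\<in>multi_indices (2 * s). (LINT x|\<mu>. mono_fun \<alpha> x) = (\<Sum>x\<in>X. v x * mono_fun \<alpha> x)"
    unfolding cone_mem_def by blast
  then have yX: "cone_mem (multi_indices (2 * s)) mono_fun X (\<lambda>\<alpha>. LINT x|\<mu>. mono_fun \<alpha> x)"
    unfolding cone_mem_def by blast
  obtain \<eta>0 and \<eta> :: "'n \<Rightarrow> real poly" where \<eta>: "\<eta>0 \<noteq> 0" "degree \<eta>0 \<le> m" "\<And>i. degree (\<eta> i) \<le> m"
    "\<And>x. x \<in> X \<Longrightarrow> \<exists>z. complex_param \<eta>0 \<eta> z x" "card {t. poly \<eta>0 t = 0} \<le> card {t. poly \<phi>0 t = 0}"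
  proof (cases "\<forall>x\<in>X. \<exists>z. complex_param \<psi>0 \<psi> z x")
    case True
    then show ?thesis using that[of \<psi>0 \<psi>, OF \<psi>0 m _ card] by blast
  next
    case False
    then obtain x where "x \<in> X" "\<forall>i. coeff (\<psi> i) m = x $ i * coeff \<psi>0 m"
      using param X(2) by blast
    \<comment> \<open>A node sits at t = \<infinity>; if \<open>coeff \<psi>0 m\<close> were 0, all
      coefficients of degree \<open>m\<close> would vanish, against \<open>lead\<close>.\<close>
    then have lead0: "coeff \<psi>0 m \<noteq> 0" using lead by auto
    show ?thesis
    proof (rule moebius_reparametrization[of \<psi>0 m \<psi> X])
      fix \<eta>0 and \<eta> :: "'n \<Rightarrow> real poly"
      assume "\<eta>0 \<noteq> 0" "degree \<eta>0 \<le> m" "\<And>i. degree (\<eta> i) \<le> m"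
        "\<And>x. x \<in> X \<Longrightarrow> \<exists>z. complex_param \<eta>0 \<eta> z x"
        "card {t. poly \<eta>0 t = 0} \<le> card {t. poly \<psi>0 t = 0}"
      then show thesis using card by (intro that[of \<eta>0 \<eta>]) auto
    qed (use m lead0 X(1,2) param in auto)
  qed
  obtain P w where P: "finite P" "\<forall>x\<in>P. 0 < w x"
    and eq: "\<forall>\<alpha>\<in>multi_indices (2 * s). (LINT x|\<mu>. mono_fun \<alpha> x) = (\<Sum>x\<in>P. w x * mono_fun \<alpha> x)"
    and cP: "card P \<le> m * s + card {t. poly \<eta>0 t = 0} + 1"
    using reduce_nodes[OF \<eta>(1-3) X(1) \<eta>(4) yX] by blast
  have "(LINT x|\<mu>. f x) = (\<Sum>x\<in>P. w x * f x)" if f: "f \<in> poly_funs (2 * s)" for f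
  proof -
    obtain c where c: "f = (\<lambda>x. \<Sum>\<alpha>\<in>multi_indices (2 * s). c \<alpha> * mono_fun \<alpha> x)"
      using f unfolding poly_funs_def by blast
    have "(LINT x|\<mu>. f x) = (\<Sum>\<alpha>\<in>multi_indices (2 * s). c \<alpha> * (LINT x|\<mu>. mono_fun \<alpha> x))"
      unfolding c using assms(9) by (simp add: finite_moments_def)
    also have "\<dots> = (\<Sum>\<alpha>\<in>multi_indices (2 * s). \<Sum>x\<in>P. w x * (c \<alpha> * mono_fun \<alpha> x))"
      using eq by (intro sum.cong refl) (simp add: sum_distrib_left mult_ac)
    also have "\<dots> = (\<Sum>x\<in>P. \<Sum>\<alpha>\<in>multi_indices (2 * s). w x * (c \<alpha> * mono_fun \<alpha> x))" by (rule sum.swap)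
    also have "\<dots> = (\<Sum>x\<in>P. w x * f x)" unfolding c by (simp add: sum_distrib_left)
    finally show ?thesis .
  qed
  then have "quadrature_rule \<mu> (2 * s) P w" using P unfolding quadrature_rule_def by blast
  moreover have "m * s + card {t. poly \<eta>0 t = 0} + 1 \<le> max (degree \<phi>0) D * s + p + 1"
    using mle \<eta>(5) unfolding assms(6) by (intro add_mono mult_right_mono) auto
  ultimately show ?thesis using cP by (meson order_trans)
qed

end
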